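(* Let $(B,C)$ be a disjoint pair of RE sets and let $T:=\mathsf{J}+\{A_n:n\in B\}+\{\neg A_n:n\in C\}$. Then: (1) $T$ does not interpret $\mathbf{R}$; (2) if $(B,C)$ is RI, then $T$ is RI; (3) if $(B,C)$ is EI, then $T$ is EI.
   Context: $\mathsf{J}$ (Janiczak's theory) is the theory in the language with a single binary relation symbol $E$ with axioms: $E$ is an equivalence relation; for each $n$, there is at most one equivalence class of size exactly $n$; for each $n$, there are at least $n$ equivalence classes with at least $n$ elements. $A_n$ is the sentence stating that there exists an equivalence class of size exactly $n+1$. $W_i$ is the RE set with index $i$; sentences are identified with Gödel numbers; $T_P=\{\ulcorner\phi\urcorner:T\vdash\phi\}$, $T_R=\{\ulcorner\phi\urcorner:T\vdash\neg\phi\}$. A disjoint pair $(X,Y)$ of RE sets is EI if there is a recursive $f(x,y)$ such that whenever $X\subseteq W_i$, $Y\subseteq W_j$, $W_i\cap W_j=\emptyset$, then $f(i,j)\notin W_i\cup W_j$; RI if no recursive set $Z$ satisfies $X\subseteq Z$, $Z\cap Y=\emptyset$. A theory $T$ is EI (RI) if $(T_P,T_R)$ is EI (RI). "Interprets" is relative interpretation. $\mathbf{R}$ is the theory in language $\{\mathbf{0},\mathbf{S},+,\cdot,\le\}$ ($x\le y$ meaning $\exists z(z+x=y)$, $\overline{n}=\mathbf{S}^n\mathbf{0}$) with axiom schemes $\overline{m}+\overline{n}=\overline{m+n}$, $\overline{m}\cdot\overline{n}=\overline{m\cdot n}$, $\overline{m}\ne\overline{n}$ ($m\ne n$), $\forall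 x(x\le\overline{n}\to x=\overline{0}\vee\dots\vee x=\overline{n})$, $\forall x(x\le\overline{n}\vee\overline{n}\le x)$. *)

theory Defs
  imports Main "HOL-Library.Nat_Bijection"
begin

section \<open>Partial recursive functions and RE sets\<close>

datatype recf =
    Zero
  | Succ
  | Proj nat
  | Comp recf "recf list"
  | PRec recf recf
  | Mu recf

text \<open>\<open>eval e xs y\<close>: the partial recursive function given by \<open>e\<close> is defined
  on the arguments \<open>xs\<close> and has the value \<open>y\<close> there. The recursion variable
  of \<open>PRec\<close> and the search variable of \<open>Mu\<close> are the first argument.
  As usual, \<open>Mu e\<close> is defined only if \<open>e\<close> converges at all
  arguments below the least zero.\<close>

inductive eval :: "recf \<Rightarrow> nat list \<Rightarrow> nat \<Rightarrow> bool" where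
  Zero: "eval Zero xs 0"
| Succ: "eval Succ [x] (Suc x)"
| Proj: "i < length xs \<Longrightarrow> eval (Proj i) xs (xs ! i)"
| Comp: "length ys = length gs \<Longrightarrow> (\<forall>i<length gs. eval (gs ! i) xs (ys ! i)) \<Longrightarrow>
    eval f ys z \<Longrightarrow> eval (Comp f gs) xs z"
| PRec_0: "eval f xs y \<Longrightarrow> eval (PRec f g) (0 # xs) y"
| PRec_Suc: "eval (PRec f g) (n # xs) y \<Longrightarrow> eval g (n # y # xs) z \<Longrightarrow>
    eval (PRec f g) (Suc n # xs) z"
| Mu: "eval f (n # xs) 0 \<Longrightarrow> (\<forall>k<n. \<exists>y. eval f (k # xs) (Suc y)) \<Longrightarrow>
    eval (Mu f) xs n"

fun code :: "recf \<Rightarrow> nat" where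
  "code Zero = prod_encode (0, 0)"
| "code Succ = prod_encode (1, 0)"
| "code (Proj i) = prod_encode (2, i)"
| "code (Comp f gs) = prod_encode (3, prod_encode (code f, list_encode (map code gs)))"
| "code (PRec f g) = prod_encode (4, prod_encode (code f, code g))"
| "code (Mu f) = prod_encode (5, code f)"

text \<open>The RE set with index \<open>i\<close> is the domain of the unary partial function
  coded by \<open>i\<close>; it is empty if \<open>i\<close> is not a code.\<close>

definition W :: "nat \<Rightarrow> nat set" where
  "W i = {x. \<exists>e y. code e = i \<and> eval e [x] y}"

definition RE :: "nat set \<Rightarrow> bool" where
  "RE X \<longleftrightarrow> (\<exists>i. X = W i)"

definition recursive_set :: "nat set \<Rightarrow> bool" where
  "recursive_set Z \<longleftrightarrow> (\<exists>e. \<forall>x v. eval e [x] v \<longleftrightarrow> v = (if x \<in> Z then 1 else 0))"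

definition recursive_fun2 :: "(nat \<Rightarrow> nat \<Rightarrow> nat) \<Rightarrow> bool" where
  "recursive_fun2 f \<longleftrightarrow> (\<exists>e. \<forall>x y v. eval e [x, y] v \<longleftrightarrow> v = f x y)"

definition disjoint_RE_pair :: "nat set \<Rightarrow> nat set \<Rightarrow> bool" where
  "disjoint_RE_pair X Y \<longleftrightarrow> RE X \<and> RE Y \<and> X \<inter> Y = {}"

definition EI :: "nat set \<Rightarrow> nat set \<Rightarrow> bool" where
  "EI X Y \<longleftrightarrow> disjoint_RE_pair X Y \<and>
    (\<exists>f. recursive_fun2 f \<and>
      (\<forall>i j. X \<subseteq> W i \<longrightarrow> Y \<subseteq> W j \<longrightarrow> W i \<inter> W j = {} \<longrightarrow> f i j \<notin> W i \<union> W j))"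

definition RI :: "nat set \<Rightarrow> nat set \<Rightarrow> bool" where
  "RI X Y \<longleftrightarrow> disjoint_RE_pair X Y \<and>
    \<not> (\<exists>Z. recursive_set Z \<and> X \<subseteq> Z \<and> Z \<inter> Y = {})"


section \<open>First-order logic with one binary relation symbol\<close>

text \<open>De Bruijn indices: \<open>All \<phi>\<close> binds variable \<open>0\<close> of \<open>\<phi>\<close>,
  and variable \<open>Suc k\<close> of \<open>\<phi>\<close> is variable \<open>k\<close> outside.\<close>

datatype fm =
    Eq nat nat
  | E nat nat
  | Neg fm
  | Imp fm fm
  | All fm

abbreviation And :: "fm \<Rightarrow> fm \<Rightarrow> fm" where
  "And \<phi> \<psi> \<equiv> Neg (Imp \<phi> (Neg \<psi>))"

abbreviation Ex :: "fm \<Rightarrow> fm" where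
  "Ex \<phi> \<equiv> Neg (All (Neg \<phi>))"

fun fv :: "fm \<Rightarrow> nat set" where
  "fv (Eq i j) = {i, j}"
| "fv (E i j) = {i, j}"
| "fv (Neg \<phi>) = fv \<phi>"
| "fv (Imp \<phi> \<psi>) = fv \<phi> \<union> fv \<psi>"
| "fv (All \<phi>) = {k. Suc k \<in> fv \<phi>}"

definition sentence :: "fm \<Rightarrow> bool" where
  "sentence \<phi> \<longleftrightarrow> fv \<phi> = {}"

text \<open>Capture-avoiding renaming of the free variables\<close>

fun ren :: "(nat \<Rightarrow> nat) \<Rightarrow> fm \<Rightarrow> fm" where
  "ren r (Eq i j) = Eq (r i) (r j)"
| "ren r (E i j) = E (r i) (r j)"
| "ren r (Neg \<phi>) = Neg (ren r \<phi>)"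
| "ren r (Imp \<phi> \<psi>) = Imp (ren r \<phi>) (ren r \<psi>)"
| "ren r (All \<phi>) = All (ren (\<lambda>k. case k of 0 \<Rightarrow> 0 | Suc j \<Rightarrow> Suc (r j)) \<phi>)"

text \<open>\<open>inst \<phi> m\<close> is the instance of \<open>All \<phi>\<close> at the variable \<open>m\<close>.\<close>

definition inst :: "fm \<Rightarrow> nat \<Rightarrow> fm" where
  "inst \<phi> m = ren (\<lambda>k. case k of 0 \<Rightarrow> m | Suc j \<Rightarrow> j) \<phi>"

text \<open>A Hilbert calculus for first-order logic with equality. The rule \<open>Gen\<close> is
  unrestricted, since \<open>T\<close> is meant to be a set of sentences.\<close>

inductive proves :: "fm set \<Rightarrow> fm \<Rightarrow> bool" (infix "\<turnstile>" 50) for T where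
  Axiom: "\<phi> \<in> T \<Longrightarrow> T \<turnstile> \<phi>"
| MP: "T \<turnstile> Imp \<phi> \<psi> \<Longrightarrow> T \<turnstile> \<phi> \<Longrightarrow> T \<turnstile> \<psi>"
| Gen: "T \<turnstile> \<phi> \<Longrightarrow> T \<turnstile> All \<phi>"
| K: "T \<turnstile> Imp \<phi> (Imp \<psi> \<phi>)"
| S: "T \<turnstile> Imp (Imp \<phi> (Imp \<psi> \<chi>)) (Imp (Imp \<phi> \<psi>) (Imp \<phi> \<chi>))"
| Contrapos: "T \<turnstile> Imp (Imp (Neg \<phi>) (Neg \<psi>)) (Imp \<psi> \<phi>)"
| Inst: "T \<turnstile> Imp (All \<phi>) (inst \<phi> m)"
| Distrib: "T \<turnstile> Imp (All (Imp \<phi> \<psi>)) (Imp (All \<phi>) (All \<psi>))"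
| Vacuous: "T \<turnstile> Imp \<phi> (All (ren Suc \<phi>))"
| Eq_refl: "T \<turnstile> Eq m m"
| Eq_subst: "T \<turnstile> Imp (Eq m n) (Imp (inst \<phi> m) (inst \<phi> n))"

fun gn :: "fm \<Rightarrow> nat" where
  "gn (Eq i j) = prod_encode (0, prod_encode (i, j))"
| "gn (E i j) = prod_encode (1, prod_encode (i, j))"
| "gn (Neg \<phi>) = prod_encode (2, gn \<phi>)"
| "gn (Imp \<phi> \<psi>) = prod_encode (3, prod_encode (gn \<phi>, gn \<psi>))"
| "gn (All \<phi>) = prod_encode (4, gn \<phi>)"

definition provable_set :: "fm set \<Rightarrow> nat set" where
  "provable_set T = {gn \<phi> |\<phi>. sentence \<phi> \<and> T \<turnstile> \<phi>}"

definition refutable_set :: "fm set \<Rightarrow> nat set" where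
  "refutable_set T = {gn \<phi> |\<phi>. sentence \<phi> \<and> T \<turnstile> Neg \<phi>}"

definition EI_theory :: "fm set \<Rightarrow> bool" where
  "EI_theory T \<longleftrightarrow> EI (provable_set T) (refutable_set T)"

definition RI_theory :: "fm set \<Rightarrow> bool" where
  "RI_theory T \<longleftrightarrow> RI (provable_set T) (refutable_set T)"


section \<open>Janiczak's theory\<close>

text \<open>The conjunction of \<open>f 0, \<dots>, f (n - 1)\<close>\<close>

fun conj_below :: "nat \<Rightarrow> (nat \<Rightarrow> fm) \<Rightarrow> fm" where
  "conj_below 0 f = All (Eq 0 0)"
| "conj_below (Suc n) f = And (conj_below n f) (f n)"

text \<open>In the scope of \<open>n\<close> existential quantifiers, the bound variables are
  \<open>0, \<dots>, n - 1\<close> and the outer variable \<open>x\<close> becomes \<open>x + n\<close>.\<close>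

definition class_at_least :: "nat \<Rightarrow> nat \<Rightarrow> fm" where
  "class_at_least n x = (Ex ^^ n)
    (And (conj_below n (\<lambda>i. E i (x + n)))
         (conj_below n (\<lambda>i. conj_below i (\<lambda>j. Neg (Eq j i)))))"

definition class_exactly :: "nat \<Rightarrow> nat \<Rightarrow> fm" where
  "class_exactly n x = And (class_at_least n x) (Neg (class_at_least (Suc n) x))"

definition E_refl :: fm where
  "E_refl = All (E 0 0)"

definition E_sym :: fm where
  "E_sym = All (All (Imp (E 1 0) (E 0 1)))"

definition E_trans :: fm where
  "E_trans = All (All (All (Imp (E 2 1) (Imp (E 1 0) (E 2 0)))))"

definition at_most_one_class :: "nat \<Rightarrow> fm" where
  "at_most_one_class n =
    All (All (Imp (And (class_exactly n 1) (class_exactly n 0)) (E 1 0)))"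

definition many_large_classes :: "nat \<Rightarrow> fm" where
  "many_large_classes n = (Ex ^^ n)
    (And (conj_below n (\<lambda>i. conj_below i (\<lambda>j. Neg (E j i))))
         (conj_below n (\<lambda>i. class_at_least n i)))"

definition J :: "fm set" where
  "J = {E_refl, E_sym, E_trans} \<union> range at_most_one_class \<union> range many_large_classes"

definition A :: "nat \<Rightarrow> fm" where
  "A n = Ex (class_exactly (n + 1) 0)"

definition J_ext :: "nat set \<Rightarrow> nat set \<Rightarrow> fm set" where
  "J_ext B C = J \<union> {A n |n. n \<in> B} \<union> {Neg (A n) |n. n \<in> C}"


section \<open>The theory R\<close>

datatype atm =
    AVar nat
  | AZero
  | ASuc atm
  | AAdd atm atm
  | AMul atm atm

text \<open>De Bruijn indices, as for \<open>fm\<close>\<close>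

datatype afm =
    AEq atm atm
  | ALe atm atm
  | ANeg afm
  | AImp afm afm
  | AAll afm

abbreviation AOr :: "afm \<Rightarrow> afm \<Rightarrow> afm" where
  "AOr \<phi> \<psi> \<equiv> AImp (ANeg \<phi>) \<psi>"

abbreviation AEx :: "afm \<Rightarrow> afm" where
  "AEx \<phi> \<equiv> ANeg (AAll (ANeg \<phi>))"

definition num :: "nat \<Rightarrow> atm" where
  "num n = (ASuc ^^ n) AZero"

text \<open>The disjunction of \<open>t = num 0, \<dots>, t = num n\<close>\<close>

fun one_of_upto :: "atm \<Rightarrow> nat \<Rightarrow> afm" where
  "one_of_upto t 0 = AEq t (num 0)"
| "one_of_upto t (Suc n) = AOr (one_of_upto t n) (AEq t (num (Suc n)))"

text \<open>The symbol for \<open>\<le>\<close> belongs to the language; the last two rules, which are the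
  two halves of the universal closure of \<open>x \<le> y \<leftrightarrow> \<exists>z. z + x = y\<close>,
  fix its meaning.\<close>

inductive_set R :: "afm set" where
  add: "AEq (AAdd (num m) (num n)) (num (m + n)) \<in> R"
| mul: "AEq (AMul (num m) (num n)) (num (m * n)) \<in> R"
| neq: "m \<noteq> n \<Longrightarrow> ANeg (AEq (num m) (num n)) \<in> R"
| le: "AAll (AImp (ALe (AVar 0) (num n)) (one_of_upto (AVar 0) n)) \<in> R"
| linear: "AAll (AOr (ALe (AVar 0) (num n)) (ALe (num n) (AVar 0))) \<in> R"
| le_def1: "AAll (AAll (AImp (ALe (AVar 1) (AVar 0))
    (AEx (AEq (AAdd (AVar 0) (AVar 2)) (AVar 1))))) \<in> R"
| le_def2: "AAll (AAll (AImp (AEx (AEq (AAdd (AVar 0) (AVar 2)) (AVar 1)))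
    (ALe (AVar 1) (AVar 0)))) \<in> R"


section \<open>Relative interpretations\<close>

text \<open>A one-dimensional, parameter-free translation of the language of arithmetic.
  Equality need not be translated to equality. A \<open>k\<close>-ary function symbol
  is translated to a formula for its graph, in which variables \<open>0, \<dots>, k - 1\<close>
  are the arguments and variable \<open>k\<close> is the value.\<close>

record transl =
  domI :: fm
  eqI :: fm
  leI :: fm
  zeroI :: fm
  sucI :: fm
  addI :: fm
  mulI :: fm

definition translation :: "transl \<Rightarrow> bool" where
  "translation I \<longleftrightarrow>
    fv (domI I) \<subseteq> {..<1} \<and> fv (eqI I) \<subseteq> {..<2} \<and> fv (leI I) \<subseteq> {..<2} \<and>
    fv (zeroI I) \<subseteq> {..<1} \<and> fv (sucI I) \<subseteq> {..<2} \<and>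
    fv (addI I) \<subseteq> {..<3} \<and> fv (mulI I) \<subseteq> {..<3}"

text \<open>\<open>app \<phi> xs\<close> is used only if the free variables of \<open>\<phi>\<close> are
  below \<open>length xs\<close>.\<close>

definition app :: "fm \<Rightarrow> nat list \<Rightarrow> fm" where
  "app \<phi> xs = ren (\<lambda>k. xs ! k) \<phi>"

text \<open>Quantifiers relativised to the domain: the free variable \<open>0\<close> of \<open>domI I\<close>
  is the variable being bound.\<close>

definition AllI :: "transl \<Rightarrow> fm \<Rightarrow> fm" where
  "AllI I \<phi> = All (Imp (domI I) \<phi>)"

definition ExI :: "transl \<Rightarrow> fm \<Rightarrow> fm" where
  "ExI I \<phi> = Ex (And (domI I) \<phi>)"

text \<open>\<open>graph I k t y\<close> says that \<open>y\<close> is a value of the term \<open>t\<close>, where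
  the variables of \<open>t\<close> are to be shifted by the number \<open>k\<close> of quantifiers that the
  unnesting of terms has introduced so far.\<close>

fun graph :: "transl \<Rightarrow> nat \<Rightarrow> atm \<Rightarrow> nat \<Rightarrow> fm" where
  "graph I k (AVar i) y = app (eqI I) [i + k, y]"
| "graph I k AZero y = app (zeroI I) [y]"
| "graph I k (ASuc t) y =
    ExI I (And (graph I (k + 1) t 0) (app (sucI I) [0, y + 1]))"
| "graph I k (AAdd s t) y =
    ExI I (ExI I (And (And (graph I (k + 2) s 1) (graph I (k + 2) t 0))
      (app (addI I) [1, 0, y + 2])))"
| "graph I k (AMul s t) y =
    ExI I (ExI I (And (And (graph I (k + 2) s 1) (graph I (k + 2) t 0))
      (app (mulI I) [1, 0, y + 2])))"

fun translate :: "transl \<Rightarrow> afm \<Rightarrow> fm" where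
  "translate I (AEq s t) =
    ExI I (ExI I (And (And (graph I 2 s 1) (graph I 2 t 0)) (app (eqI I) [1, 0])))"
| "translate I (ALe s t) =
    ExI I (ExI I (And (And (graph I 2 s 1) (graph I 2 t 0)) (app (leI I) [1, 0])))"
| "translate I (ANeg \<phi>) = Neg (translate I \<phi>)"
| "translate I (AImp \<phi> \<psi>) = Imp (translate I \<phi>) (translate I \<psi>)"
| "translate I (AAll \<phi>) = AllI I (translate I \<phi>)"

text \<open>The translated axioms of equality, with function symbols
  replaced by their graphs\<close>

definition congruent :: "transl \<Rightarrow> nat \<Rightarrow> fm \<Rightarrow> fm" where
  "congruent I n \<phi> = (AllI I ^^ (2 * n))
    (Imp (And (conj_below n (\<lambda>i. app (eqI I) [i, n + i])) (app \<phi> [0..<n]))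
      (app \<phi> [n..<2 * n]))"

definition total :: "transl \<Rightarrow> nat \<Rightarrow> fm \<Rightarrow> fm" where
  "total I n \<phi> = (AllI I ^^ n) (ExI I (app \<phi> ([1..<n + 1] @ [0])))"

definition single_valued :: "transl \<Rightarrow> nat \<Rightarrow> fm \<Rightarrow> fm" where
  "single_valued I n \<phi> = (AllI I ^^ (n + 2))
    (Imp (And (app \<phi> ([2..<n + 2] @ [0])) (app \<phi> ([2..<n + 2] @ [1])))
      (app (eqI I) [0, 1]))"

definition equality_axioms :: "transl \<Rightarrow> fm set" where
  "equality_axioms I =
    {AllI I (app (eqI I) [0, 0]), congruent I 2 (eqI I), congruent I 2 (leI I)} \<union>
    (\<Union>(n, \<phi>) \<in> {(0, zeroI I), (1, sucI I), (2, addI I), (2, mulI I)}.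
      {total I n \<phi>, single_valued I n \<phi>, congruent I (n + 1) \<phi>})"

definition interprets :: "fm set \<Rightarrow> afm set \<Rightarrow> bool" where
  "interprets T U \<longleftrightarrow>
    (\<exists>I. translation I \<and> (\<forall>\<phi> \<in> equality_axioms I. T \<turnstile> \<phi>) \<and>
      (\<forall>\<phi> \<in> U. T \<turnstile> translate I \<phi>))"

end

theory Submission
  imports Defs
begin

text \<open>The theory \<open>T\<close> has a model in which the class of size \<open>n + 1\<close> exists iff
  \<open>n \<in> B\<close> and in which infinitely many classes are infinite; hence \<open>T\<close> is consistent.

  The map sending \<open>n\<close> to the Goedel number of \<open>A n\<close> is recursive and carries \<open>(B, C)\<close> into
  (provable, refutable), so separating sets pull back along it, and indices of RE sets are
  pulled back by composing programs. It remains to see that the theorems form an RE set; this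
  is arithmetised with semidecidable predicates, that is projections of decidable ones.

  If \<open>T\<close> interpreted \<open>R\<close>, then in the model the translation of \<open>\<le>\<close> would linearly order the
  infinitely many (values of) numerals. All but finitely many elements lie in classes that a
  formula of the given quantifier depth cannot tell from infinite ones, and by an
  Ehrenfeucht-Fraisse argument such a formula is symmetric on pairs of such elements.\<close>

section \<open>Computable functions and semidecidable predicates\<close>

text \<open>Programs are built explicitly only for a few closure rules, for search, for passing
  between environments and argument lists, and for the composition behind (3). The rest follows the
  shape of a predicate by introduction rules. What resists this is syntax: free variables, renaming
  and provability are recursions over formulas, not numbers, and the first two change a parameter
  below quantifiers. Each is therefore recast as a set of tuples closed under rules with at most two
  premises, and the one construction \<open>generated\<close> treats them all. Evaluation is shown
  semidecidable for each program separately, which suffices because \<open>T\<close> involves one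
  index for \<open>B\<close> and one for \<open>C\<close>.

  For (1), equality may be interpreted by any definable congruence, so a numeral can have many
  values; choosing one for each numeral still gives infinitely many elements. Two elements of large
  classes can be interchanged even if their classes differ in size, provided that neither class can
  be exhausted within the depth of the formula.\<close>

inductive_cases eval_ZeroE: "eval Zero xs y"
inductive_cases eval_SuccE: "eval Succ xs y"
inductive_cases eval_ProjE: "eval (Proj i) xs y"
inductive_cases eval_CompE: "eval (Comp f gs) xs y"
inductive_cases eval_PRec_0E: "eval (PRec f g) (0 # xs) y"
inductive_cases eval_PRec_SucE: "eval (PRec f g) (Suc n # xs) y"
inductive_cases eval_MuE: "eval (Mu f) xs y"

lemmas eval_elims = eval_ZeroE eval_SuccE eval_ProjE eval_CompE eval_PRec_0E eval_PRec_SucE eval_MuE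

lemma eval_det: "eval e xs y \<Longrightarrow> eval e xs z \<Longrightarrow> z = y"
proof (induction arbitrary: z rule: eval.induct)
  case (Comp ys gs xs f y)
  from Comp.prems obtain ys' where ys': "length ys' = length gs"
    "\<forall>i<length gs. eval (gs ! i) xs (ys' ! i)" "eval f ys' z"
    by (auto elim: eval_elims)
  have "ys' = ys"
    using Comp.IH(1) Comp.hyps(1) ys'(1,2) by (auto intro!: nth_equalityI)
  with Comp.IH(2) ys'(3) show ?case by simp
next
  case (PRec_Suc f g n xs y y')
  from PRec_Suc.prems obtain u where "eval (PRec f g) (n # xs) u" "eval g (n # u # xs) z"
    by (auto elim: eval_elims)
  with PRec_Suc.IH show ?case by auto
next
  case (Mu f n xs)
  from Mu.prems have z: "eval f (z # xs) 0" "\<forall>k<z. \<exists>y. eval f (k # xs) (Suc y)"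
    by (auto elim: eval_elims)
  have "\<not> z < n" using Mu.IH(2) z(1) by fastforce
  moreover have "\<not> n < z" using Mu.IH(1) z(2) by fastforce
  ultimately show ?case by simp
next
  case (PRec_0 f xs y g)
  from PRec_0.prems have "eval f xs z" by (rule eval_PRec_0E)
  then show ?case by (rule PRec_0.IH)
qed (erule eval_elims; simp)+

lemma map_case_nat: "map (case_nat x s) [0..<Suc n] = x # map s [0..<n]"
  by (simp add: upt_conv_Cons map_Suc_upt[symmetric] del: upt_Suc)

text \<open>Functions of several arguments take them from an environment \<open>s :: nat \<Rightarrow> nat\<close>,
  of which only finitely many entries may be used. Binding a variable pushes it to the
  front of the environment, as for de Bruijn indices.\<close>

definition computable :: "((nat \<Rightarrow> nat) \<Rightarrow> nat) \<Rightarrow> bool" where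
  "computable F \<longleftrightarrow> (\<exists>n e. \<forall>s. eval e (map s [0..<n]) (F s))"

text \<open>Projections discard surplus arguments, so a program can be padded to any larger arity.
  This brings finitely many programs to one common arity.\<close>

lemma computable_arity:
  assumes "computable F"
  shows "\<exists>n0. \<forall>n\<ge>n0. \<exists>e. \<forall>s. eval e (map s [0..<n]) (F s)"
proof -
  from assms obtain n0 e where e: "\<And>s. eval e (map s [0..<n0]) (F s)"
    by (auto simp: computable_def)
  have "eval (Comp e (map Proj [0..<n0])) (map s [0..<n]) (F s)" if "n \<ge> n0" for n s
  proof (rule eval.Comp[OF _ _ e])
    show "\<forall>i<length (map Proj [0..<n0]).
        eval (map Proj [0..<n0] ! i) (map s [0..<n]) (map s [0..<n0] ! i)"
    proof (intro allI impI)
      fix i assume i: "i < length (map Proj [0..<n0])"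
      then show "eval (map Proj [0..<n0] ! i) (map s [0..<n]) (map s [0..<n0] ! i)"
        using eval.Proj[of i "map s [0..<n]"] that by simp
    qed
  qed simp
  then show ?thesis by blast
qed

text \<open>The family \<open>G\<close> is infinite, but \<open>F\<close> reads only the entries
  below some \<open>n\<close>, so one \<open>Comp\<close> with \<open>n\<close> inner programs is
  enough.\<close>

lemma computable_subst:
  assumes F: "computable F" and G: "\<And>i. computable (G i)"
  shows "computable (\<lambda>s. F (\<lambda>i. G i s))"
proof -
  from F obtain n e where e: "\<And>s. eval e (map s [0..<n]) (F s)"
    by (auto simp: computable_def)
  obtain N where N: "\<And>i m. m \<ge> N i \<Longrightarrow> \<exists>e. \<forall>s. eval e (map s [0..<m]) (G i s)"
    using computable_arity[OF G] by metis
  \<comment> \<open>The sum serves as an upper bound for the \<open>n\<close> arities.\<close>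
  define m where "m = sum N {..<n}"
  have "\<exists>e. \<forall>s. eval e (map s [0..<m]) (G i s)" if "i < n" for i
    unfolding m_def by (rule N) (use that in \<open>auto intro: member_le_sum\<close>)
  then obtain g where g: "\<And>i s. i < n \<Longrightarrow> eval (g i) (map s [0..<m]) (G i s)"
    by metis
  have "eval (Comp e (map g [0..<n])) (map s [0..<m]) (F (\<lambda>i. G i s))" for s
    by (rule eval.Comp[OF _ _ e]) (auto simp: g)
  then show ?thesis by (auto simp: computable_def)
qed

lemma computable_var: "computable (\<lambda>s. s i)"
  unfolding computable_def
proof (intro exI allI)
  fix s :: "nat \<Rightarrow> nat"
  show "eval (Proj i) (map s [0..<Suc i]) (s i)"
    using eval.Proj[of i "map s [0..<Suc i]"] by (simp del: upt_Suc)
qed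

lemma computable_Suc_0: "computable (\<lambda>s. Suc (s 0))"
  unfolding computable_def using eval.Succ
  by (intro exI[of _ 1] exI[of _ Succ]) (simp add: One_nat_def)

lemma computable_zero: "computable (\<lambda>s. 0)"
  unfolding computable_def using eval.Zero by blast

lemma computable_comp:
  assumes "computable (\<lambda>s. h (s 0))" "computable f"
  shows "computable (\<lambda>s. h (f s))"
  using computable_subst[OF assms(1), of "\<lambda>i. f"] assms(2) by simp

lemma computable_comp2:
  assumes "computable (\<lambda>s. h (s 0) (s 1))" "computable f" "computable g"
  shows "computable (\<lambda>s. h (f s) (g s))"
proof -
  have "computable (case_nat f (\<lambda>_. g) i)" for i
    using assms(2,3) by (cases i) auto
  with computable_subst[OF assms(1), of "case_nat f (\<lambda>_. g)"] show ?thesis by simp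
qed

lemma computable_Suc: "computable f \<Longrightarrow> computable (\<lambda>s. Suc (f s))"
  by (rule computable_comp[OF computable_Suc_0])

lemma computable_const: "computable (\<lambda>s. c)"
  by (induction c) (auto intro: computable_zero computable_Suc)

text \<open>\<open>PRec\<close> passes the counter and the previous value in front of the
  parameters, which is the environment of \<open>g\<close> with two entries pushed. The recursion
  argument is replaced by \<open>b\<close> through substitution at the end.\<close>

lemma computable_rec_nat:
  assumes f: "computable f" and g: "computable (\<lambda>s. g (s 0) (s 1) (\<lambda>i. s (Suc (Suc i))))"
    and b: "computable b"
  shows "computable (\<lambda>s. rec_nat (f s) (\<lambda>k y. g k y s) (b s))"
proof -
  from computable_arity[OF f] obtain m where
    m: "\<And>n. n \<ge> m \<Longrightarrow> \<exists>e. \<forall>s. eval e (map s [0..<n]) (f s)" by blast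
  from computable_arity[OF g] obtain m' where
    m': "\<And>n. n \<ge> m' \<Longrightarrow>
      \<exists>e. \<forall>s. eval e (map s [0..<n]) (g (s 0) (s 1) (\<lambda>i. s (Suc (Suc i))))" by blast
  define n where "n = m + m'"
  from m[of n] obtain ef where ef: "\<And>s. eval ef (map s [0..<n]) (f s)"
    by (auto simp: n_def)
  from m'[of "Suc (Suc n)"] obtain eg where
    eg: "\<And>s. eval eg (map s [0..<Suc (Suc n)]) (g (s 0) (s 1) (\<lambda>i. s (Suc (Suc i))))"
    by (auto simp: n_def simp del: upt_Suc)
  have eg': "eval eg (k # y # map s [0..<n]) (g k y s)" for k y s
    using eg[of "case_nat k (case_nat y s)"] by (simp add: map_case_nat del: upt_Suc)
  have "eval (PRec ef eg) (k # map s [0..<n]) (rec_nat (f s) (\<lambda>k y. g k y s) k)" for k s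
    by (induction k) (auto intro: eval.PRec_0 eval.PRec_Suc ef eg')
  from this[of "s 0" "\<lambda>i. s (Suc i)" for s]
  have "eval (PRec ef eg) (map s [0..<Suc n])
      (rec_nat (f (\<lambda>i. s (Suc i))) (\<lambda>k y. g k y (\<lambda>i. s (Suc i))) (s 0))" for s
    by (simp add: upt_conv_Cons map_Suc_upt[symmetric] comp_def del: upt_Suc)
  then have *: "computable (\<lambda>s. rec_nat (f (\<lambda>i. s (Suc i)))
      (\<lambda>k y. g k y (\<lambda>i. s (Suc i))) (s 0))"
    by (auto simp: computable_def simp del: upt_Suc)
  have "computable (case_nat b (\<lambda>i s. s i) i)" for i
    by (cases i) (auto intro: b computable_var)
  with computable_subst[OF *, of "case_nat b (\<lambda>i s. s i)"] show ?thesis by simp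
qed

lemma computable_add:
  assumes "computable f" "computable g" shows "computable (\<lambda>s. f s + g s)"
proof -
  have "x + y = rec_nat x (\<lambda>_ z. Suc z) y" for x y by (induction y) auto
  then show ?thesis
    by (simp only:) (intro computable_rec_nat computable_Suc computable_var assms)
qed

lemma computable_shift: "computable f \<Longrightarrow> computable (\<lambda>s. f (\<lambda>i. s (i + k)))"
  using computable_subst[of f "\<lambda>i s. s (i + k)"] computable_var by simp

lemma computable_mult:
  assumes "computable f" "computable g" shows "computable (\<lambda>s. f s * g s)"
proof -
  have "x * y = rec_nat 0 (\<lambda>_ z. z + x) y" for x y by (induction y) auto
  moreover have "computable (\<lambda>s. rec_nat 0 (\<lambda>_ z. z + f s) (g s))"
    using computable_shift[OF assms(1), of 2]
    by (intro computable_rec_nat computable_add computable_const computable_var assms(2)) simp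
  ultimately show ?thesis by simp
qed

lemma computable_diff:
  assumes "computable f" "computable g" shows "computable (\<lambda>s. f s - g s)"
proof -
  have "x - 1 = rec_nat 0 (\<lambda>k _. k) x" for x :: nat by (cases x) auto
  then have pred: "computable (\<lambda>s. h s - 1)" if "computable h" for h
    by (simp only:) (intro computable_rec_nat computable_const computable_var that)
  have "x - y = rec_nat x (\<lambda>_ z. z - 1) y" for x y :: nat by (induction y) auto
  then have "(\<lambda>s. f s - g s) = (\<lambda>s. rec_nat (f s) (\<lambda>_ z. z - 1) (g s))" by (rule ext)
  moreover have "computable (\<lambda>s. rec_nat (f s) (\<lambda>_ z. z - 1) (g s))"
    by (intro computable_rec_nat pred computable_var assms)
  ultimately show ?thesis by (simp only:)
qed

section \<open>Decidable predicates and search\<close>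

definition decidable :: "((nat \<Rightarrow> nat) \<Rightarrow> bool) \<Rightarrow> bool" where
  "decidable P \<longleftrightarrow> computable (\<lambda>s. of_bool (P s))"

lemma decidable_subst:
  assumes "decidable P" "\<And>i. computable (G i)"
  shows "decidable (\<lambda>s. P (\<lambda>i. G i s))"
  using assms computable_subst[of "\<lambda>s. of_bool (P s)"] by (simp add: decidable_def)

lemma decidable_const: "decidable (\<lambda>s. b)"
  by (simp add: decidable_def computable_const)

lemma decidable_not: "decidable P \<Longrightarrow> decidable (\<lambda>s. \<not> P s)"
proof -
  assume "decidable P"
  moreover have "of_bool (\<not> P s) = 1 - (of_bool (P s) :: nat)" for s by simp
  ultimately show ?thesis
    unfolding decidable_def by (simp only:) (intro computable_diff computable_const)
qed

lemma decidable_conj: "decidable P \<Longrightarrow> decidable Q \<Longrightarrow> decidable (\<lambda>s. P s \<and> Q s)"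
  using computable_mult[of "\<lambda>s. of_bool (P s)" "\<lambda>s. of_bool (Q s)"]
  by (simp add: decidable_def of_bool_conj)

lemma decidable_disj: "decidable P \<Longrightarrow> decidable Q \<Longrightarrow> decidable (\<lambda>s. P s \<or> Q s)"
  using decidable_not[OF decidable_conj[OF decidable_not decidable_not, of P Q]] by simp

lemma decidable_le:
  assumes "computable f" "computable g" shows "decidable (\<lambda>s. f s \<le> g s)"
proof -
  have "of_bool (f s \<le> g s) = 1 - (f s - g s)" for s by auto
  then show ?thesis unfolding decidable_def
    by (simp only:) (intro computable_diff computable_const assms)
qed

lemma decidable_less:
  assumes "computable f" "computable g" shows "decidable (\<lambda>s. f s < g s)"
  using decidable_le[OF computable_Suc[OF assms(1)] assms(2)] by (simp add: Suc_le_eq)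

lemma decidable_eq:
  assumes "computable f" "computable g" shows "decidable (\<lambda>s. f s = g s)"
  using decidable_conj[OF decidable_le[OF assms] decidable_le[OF assms(2,1)]]
  by (simp add: eq_iff[symmetric])

lemma decidable_bex:
  assumes P: "decidable (\<lambda>s. P (s 0) (\<lambda>i. s (Suc i)))" and f: "computable f"
  shows "decidable (\<lambda>s. \<exists>k<f s. P k s)"
proof -
  \<comment> \<open>The recursion records in a number whether a witness has been met so far.\<close>
  have *: "0 < rec_nat 0 (\<lambda>k y. of_bool (P k s \<or> 0 < y) :: nat) n \<longleftrightarrow> (\<exists>k<n. P k s)" for n s
    by (induction n) (auto simp: less_Suc_eq)
  have "decidable (\<lambda>s. P (s 0) (\<lambda>i. s (Suc (Suc i))))"
    using decidable_subst[OF P, of "case_nat (\<lambda>s. s 0) (\<lambda>i s. s (Suc (Suc i)))"]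
    by (simp add: computable_var split: nat.split)
  then have "decidable (\<lambda>s. P (s 0) (\<lambda>i. s (Suc (Suc i))) \<or> 0 < s 1)"
    by (intro decidable_disj decidable_less computable_const computable_var)
  then have "computable (\<lambda>s. rec_nat 0 (\<lambda>k y. of_bool (P k s \<or> 0 < y)) (f s))"
    unfolding decidable_def by (intro computable_rec_nat f computable_const)
  from decidable_less[OF computable_const[of 0] this] show ?thesis by (simp only: *)
qed

text \<open>\<open>Mu\<close> looks for a zero, hence the characteristic function of the negation.
  The assumption \<open>ex\<close> makes the search total, as \<open>computable\<close>
  demands.\<close>

lemma computable_Least:
  assumes P: "decidable (\<lambda>s. P (s 0) (\<lambda>i. s (Suc i)))" and ex: "\<And>s. \<exists>k. P k s"
  shows "computable (\<lambda>s. LEAST k. P k s)"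
proof -
  have "computable (\<lambda>s. of_bool (\<not> P (s 0) (\<lambda>i. s (Suc i))))"
    using decidable_not[OF P] by (simp add: decidable_def)
  \<comment> \<open>An arity of the form \<open>Suc m\<close> ensures that the search variable is
    among the arguments.\<close>
  from computable_arity[OF this] obtain m e where
    "\<And>s. eval e (map s [0..<Suc m]) (of_bool (\<not> P (s 0) (\<lambda>i. s (Suc i))))"
    using le_SucI by blast
  from this[of "case_nat k s" for k s]
  have e: "eval e (k # map s [0..<m]) (of_bool (\<not> P k s))" for k s
    by (simp add: map_case_nat del: upt_Suc)
  have "eval (Mu e) (map s [0..<m]) (LEAST k. P k s)" for s
  proof (rule eval.Mu)
    show "eval e ((LEAST k. P k s) # map s [0..<m]) 0"
      using e[of "LEAST k. P k s" s] LeastI_ex[OF ex[of s]] by simp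
    show "\<forall>k<LEAST k. P k s. \<exists>y. eval e (k # map s [0..<m]) (Suc y)"
      using e[of _ s] not_less_Least[of _ "\<lambda>k. P k s"] by (metis One_nat_def of_bool_eq(2))
  qed
  then show ?thesis by (auto simp: computable_def)
qed

lemma computable_prod_encode:
  assumes "computable f" "computable g" shows "computable (\<lambda>s. prod_encode (f s, g s))"
proof -
  have "triangle n = rec_nat 0 (\<lambda>k y. y + Suc k) n" for n by (induction n) auto
  then show ?thesis unfolding prod_encode_def
    by simp (intro computable_add computable_rec_nat computable_const computable_var
        computable_Suc assms)
qed

lemma prod_encode_bounds: "a \<le> prod_encode (a, b)" "b \<le> prod_encode (a, b)"
  by (rule le_prod_encode_1 le_prod_encode_2)+

text \<open>Components never exceed the code of their pair, so each is found by a search in which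
  the other one ranges below a bound.\<close>

lemma computable_prod_decode:
  assumes "computable f"
  shows "computable (\<lambda>s. fst (prod_decode (f s)))" "computable (\<lambda>s. snd (prod_decode (f s)))"
proof -
  have fst: "\<exists>b<Suc z. prod_encode (fst (prod_decode z), b) = z" for z
    using prod_encode_bounds(2)[of "snd (prod_decode z)" "fst (prod_decode z)"]
    by (intro exI[of _ "snd (prod_decode z)"]) (auto simp: less_Suc_eq_le)
  have snd: "\<exists>a<Suc z. prod_encode (a, snd (prod_decode z)) = z" for z
    using prod_encode_bounds(1)[of "fst (prod_decode z)" "snd (prod_decode z)"]
    by (intro exI[of _ "fst (prod_decode z)"]) (auto simp: less_Suc_eq_le)
  have 1: "fst (prod_decode z) = (LEAST a. \<exists>b<Suc z. prod_encode (a, b) = z)" for z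
    by (rule Least_equality[symmetric]) (use fst in auto)
  have 2: "snd (prod_decode z) = (LEAST b. \<exists>a<Suc z. prod_encode (a, b) = z)" for z
    by (rule Least_equality[symmetric]) (use snd in auto)
  have ex: "\<exists>a. \<exists>b<Suc z. prod_encode (a, b) = z" "\<exists>b. \<exists>a<Suc z. prod_encode (a, b) = z" for z
    using fst snd by blast+
  show "computable (\<lambda>s. fst (prod_decode (f s)))"
    by (rule computable_comp[OF _ assms], unfold 1)
      (intro computable_Least ex decidable_bex decidable_eq computable_prod_encode
        computable_var computable_Suc)
  show "computable (\<lambda>s. snd (prod_decode (f s)))"
    by (rule computable_comp[OF _ assms], unfold 2)
      (intro computable_Least ex decidable_bex decidable_eq computable_prod_encode
        computable_var computable_Suc)
qed

section \<open>Semidecidable predicates and their closure properties\<close>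

definition semidecidable :: "((nat \<Rightarrow> nat) \<Rightarrow> bool) \<Rightarrow> bool" where
  "semidecidable P \<longleftrightarrow>
    (\<exists>Q. decidable (\<lambda>s. Q (s 0) (\<lambda>i. s (Suc i))) \<and> (\<forall>s. P s \<longleftrightarrow> (\<exists>t. Q t s)))"

lemma semidecidableI:
  assumes "decidable (\<lambda>s. Q (s 0) (\<lambda>i. s (Suc i)))" "\<And>s. P s \<longleftrightarrow> (\<exists>t. Q t s)"
  shows "semidecidable P"
  using assms unfolding semidecidable_def by blast

lemma semidecidableE:
  assumes "semidecidable P"
  obtains Q where "decidable (\<lambda>s. Q (s 0) (\<lambda>i. s (Suc i)))" "\<And>s. P s \<longleftrightarrow> (\<exists>t. Q t s)"
  using assms unfolding semidecidable_def by blast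

lemma decidable_subst_Suc:
  assumes Q: "decidable (\<lambda>s. Q (s 0) (\<lambda>i. s (Suc i)))"
    and "computable f" "\<And>i. computable (G i)"
  shows "decidable (\<lambda>s. Q (f s) (\<lambda>i. G i s))"
  using decidable_subst[OF Q, of "case_nat f G"] assms(2,3) by (simp split: nat.split)

lemma decidable_semidecidable:
  assumes "decidable P" shows "semidecidable P"
  by (rule semidecidableI[of "\<lambda>t. P"])
    (use decidable_subst[OF assms, of "\<lambda>i s. s (Suc i)"] in \<open>auto intro: computable_var\<close>)

lemma semidecidable_subst:
  assumes P: "semidecidable P" and G: "\<And>i. computable (G i)"
  shows "semidecidable (\<lambda>s. P (\<lambda>i. G i s))"
proof -
  from P obtain Q where Q: "decidable (\<lambda>s. Q (s 0) (\<lambda>i. s (Suc i)))" "\<And>s. P s \<longleftrightarrow> (\<exists>t. Q t s)"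
    by (rule semidecidableE) blast
  have "computable (\<lambda>s. G i (\<lambda>i. s (Suc i)))" for i
    using computable_shift[OF G[of i], of 1] by simp
  from decidable_subst_Suc[OF Q(1) computable_var[of 0], of "\<lambda>i s. G i (\<lambda>i. s (Suc i))"] this
  show ?thesis
    by (intro semidecidableI[of "\<lambda>t s. Q t (\<lambda>i. G i s)"]) (auto simp: Q(2))
qed

text \<open>The new witness is a common bound for the two old ones; a bounded search below it
  recovers them.\<close>

lemma semidecidable_conj:
  assumes "semidecidable P" "semidecidable P'"
  shows "semidecidable (\<lambda>s. P s \<and> P' s)"
proof -
  from assms(1) obtain Q where Q: "decidable (\<lambda>s. Q (s 0) (\<lambda>i. s (Suc i)))" "\<And>s. P s \<longleftrightarrow> (\<exists>t. Q t s)"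
    by (rule semidecidableE) blast
  from assms(2) obtain Q' where
    Q': "decidable (\<lambda>s. Q' (s 0) (\<lambda>i. s (Suc i)))" "\<And>s. P' s \<longleftrightarrow> (\<exists>t. Q' t s)"
    by (rule semidecidableE) blast
  show ?thesis
  proof (rule semidecidableI[of "\<lambda>b s. (\<exists>t<b. Q t s) \<and> (\<exists>t<b. Q' t s)"])
    show "decidable (\<lambda>s. (\<exists>t<s 0. Q t (\<lambda>i. s (Suc i))) \<and> (\<exists>t<s 0. Q' t (\<lambda>i. s (Suc i))))"
      by (intro decidable_conj decidable_bex computable_var
          decidable_subst_Suc[OF Q(1)] decidable_subst_Suc[OF Q'(1)])
    show "P s \<and> P' s \<longleftrightarrow> (\<exists>b. (\<exists>t<b. Q t s) \<and> (\<exists>t<b. Q' t s))" for s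
    proof
      assume "P s \<and> P' s"
      then obtain t t' where "Q t s" "Q' t' s" by (auto simp: Q(2) Q'(2))
      then show "\<exists>b. (\<exists>t<b. Q t s) \<and> (\<exists>t<b. Q' t s)"
        by (intro exI[of _ "Suc (t + t')"] conjI exI[of _ t] exI[of _ t']) auto
    qed (auto simp: Q(2) Q'(2))
  qed
qed

lemma semidecidable_disj:
  assumes "semidecidable P" "semidecidable P'"
  shows "semidecidable (\<lambda>s. P s \<or> P' s)"
proof -
  from assms(1) obtain Q where Q: "decidable (\<lambda>s. Q (s 0) (\<lambda>i. s (Suc i)))" "\<And>s. P s \<longleftrightarrow> (\<exists>t. Q t s)"
    by (rule semidecidableE) blast
  from assms(2) obtain Q' where
    Q': "decidable (\<lambda>s. Q' (s 0) (\<lambda>i. s (Suc i)))" "\<And>s. P' s \<longleftrightarrow> (\<exists>t. Q' t s)"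
    by (rule semidecidableE) blast
  show ?thesis
    by (rule semidecidableI[of "\<lambda>t s. Q t s \<or> Q' t s"])
      (auto simp: Q(2) Q'(2) intro!: decidable_disj Q(1) Q'(1))
qed

text \<open>Again one bound stands for two witnesses, the value \<open>k\<close> and the witness for
  \<open>P k\<close>.\<close>

lemma semidecidable_ex:
  assumes P: "semidecidable (\<lambda>s. P (s 0) (\<lambda>i. s (Suc i)))"
  shows "semidecidable (\<lambda>s. \<exists>k. P k s)"
proof -
  from P obtain Q where Q: "decidable (\<lambda>s. Q (s 0) (\<lambda>i. s (Suc i)))"
    "\<And>s. P (s 0) (\<lambda>i. s (Suc i)) \<longleftrightarrow> (\<exists>t. Q t s)"
    by (rule semidecidableE) blast
  have Q2: "P k s \<longleftrightarrow> (\<exists>t. Q t (case_nat k s))" for k s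
    using Q(2)[of "case_nat k s"] by simp
  show ?thesis
  proof (rule semidecidableI[of "\<lambda>b s. \<exists>k<b. \<exists>t<b. Q t (case_nat k s)"])
    \<comment> \<open>The bounded quantifiers push \<open>t\<close> and \<open>k\<close> in front of
      the bound; the environment of \<open>Q\<close> keeps \<open>k\<close> and skips the
      bound.\<close>
    have "case_nat (s (Suc 0)) (\<lambda>i. s (Suc (Suc (Suc i))))
        = (\<lambda>i. case_nat (\<lambda>s. s (Suc 0)) (\<lambda>i s. s (Suc (Suc (Suc i)))) i s)" for s :: "nat \<Rightarrow> nat"
      by (auto split: nat.split)
    then show "decidable (\<lambda>s. \<exists>k<s 0. \<exists>t<s 0. Q t (case_nat k (\<lambda>i. s (Suc i))))"
      by (intro decidable_bex computable_var)
        (simp only:, intro decidable_subst_Suc[OF Q(1)] computable_var,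
          simp add: computable_var split: nat.split)
    show "(\<exists>k. P k s) \<longleftrightarrow> (\<exists>b. \<exists>k<b. \<exists>t<b. Q t (case_nat k s))" for s
    proof
      assume "\<exists>k. P k s"
      then obtain k t where "Q t (case_nat k s)" by (auto simp: Q2)
      then show "\<exists>b. \<exists>k<b. \<exists>t<b. Q t (case_nat k s)"
        by (intro exI[of _ "Suc (k + t)"] exI[of _ k] conjI exI[of _ t]) auto
    qed (auto simp: Q2)
  qed
qed

text \<open>This is collection: the finitely many witnesses have a common bound, for instance the
  successor of their sum, and that bound is a single witness for the whole statement.\<close>

lemma semidecidable_ball:
  assumes P: "semidecidable (\<lambda>s. P (s 0) (\<lambda>i. s (Suc i)))" and f: "computable f"
  shows "semidecidable (\<lambda>s. \<forall>k<f s. P k s)"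
proof -
  from P obtain Q where Q: "decidable (\<lambda>s. Q (s 0) (\<lambda>i. s (Suc i)))"
    "\<And>s. P (s 0) (\<lambda>i. s (Suc i)) \<longleftrightarrow> (\<exists>t. Q t s)"
    by (rule semidecidableE) blast
  have Q2: "P k s \<longleftrightarrow> (\<exists>t. Q t (case_nat k s))" for k s
    using Q(2)[of "case_nat k s"] by simp
  show ?thesis
  proof (rule semidecidableI[of "\<lambda>b s. \<not> (\<exists>k<f s. \<not> (\<exists>t<b. Q t (case_nat k s)))"])
    have f': "computable (\<lambda>s. f (\<lambda>i. s (Suc i)))" using computable_shift[OF f, of 1] by simp
    have "case_nat (s (Suc 0)) (\<lambda>i. s (Suc (Suc (Suc i))))
        = (\<lambda>i. case_nat (\<lambda>s. s (Suc 0)) (\<lambda>i s. s (Suc (Suc (Suc i)))) i s)" for s :: "nat \<Rightarrow> nat"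
      by (auto split: nat.split)
    then show "decidable (\<lambda>s. \<not> (\<exists>k<f (\<lambda>i. s (Suc i)).
        \<not> (\<exists>t<s 0. Q t (case_nat k (\<lambda>i. s (Suc i))))))"
      by (intro decidable_not decidable_bex computable_var f')
        (simp only:, intro decidable_subst_Suc[OF Q(1)] computable_var,
          simp add: computable_var split: nat.split)
    show "(\<forall>k<f s. P k s) \<longleftrightarrow> (\<exists>b. \<not> (\<exists>k<f s. \<not> (\<exists>t<b. Q t (case_nat k s))))" for s
    proof
      assume "\<forall>k<f s. P k s"
      then obtain t where t: "\<And>k. k < f s \<Longrightarrow> Q (t k) (case_nat k s)"
        unfolding Q2 by metis
      have "t k < Suc (sum t {..<f s})" if "k < f s" for k
        using member_le_sum[of k "{..<f s}" t] that by (simp add: less_Suc_eq_le)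
      with t show "\<exists>b. \<not> (\<exists>k<f s. \<not> (\<exists>t<b. Q t (case_nat k s)))"
        by (intro exI[of _ "Suc (sum t {..<f s})"]) blast
    qed (auto simp: Q2)
  qed
qed

lemma semidecidable_bex:
  assumes "semidecidable (\<lambda>s. P (s 0) (\<lambda>i. s (Suc i)))" "computable f"
  shows "semidecidable (\<lambda>s. \<exists>k<f s. P k s)"
  by (intro semidecidable_ex semidecidable_conj assms(1) decidable_semidecidable decidable_less
      computable_var computable_shift[OF assms(2), of 1, simplified])

text \<open>The conjuncts may depend on \<open>i\<close> in no uniform way, as with the list of
  inner programs of a \<open>Comp\<close>.\<close>

lemma semidecidable_ball_const:
  fixes n :: nat assumes "\<And>i. i < n \<Longrightarrow> semidecidable (P i)"
  shows "semidecidable (\<lambda>s. \<forall>i<n. P i s)"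
  using assms
proof (induction n)
  case 0
  then show ?case by (simp add: decidable_semidecidable decidable_const)
next
  case (Suc n)
  then have "semidecidable (\<lambda>s. (\<forall>i<n. P i s) \<and> P n s)" by (intro semidecidable_conj) auto
  then show ?case by (simp add: All_less_Suc conj_commute)
qed

section \<open>Semidecidable sets are RE\<close>

lemma code_inj: "code e = code e' \<Longrightarrow> e = e'"
proof (induction e arbitrary: e')
  case (Comp f gs)
  then obtain f' gs' where e': "e' = Comp f' gs'" by (cases e') auto
  with Comp.prems have "code f = code f'" and map: "map code gs = map code gs'"
    by (auto dest: list_encode_eq[THEN iffD1])
  have "gs = gs'"
  proof (rule nth_equalityI)
    show len: "length gs = length gs'" using map map_eq_imp_length_eq by blast
    fix i assume "i < length gs"
    then show "gs ! i = gs' ! i"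
      using Comp.IH(2) map len by (metis nth_map nth_mem)
  qed
  with Comp.IH(1) \<open>code f = code f'\<close> e' show ?case by simp
qed (case_tac e'; simp)+

lemma W_code: "W (code e) = {x. \<exists>y. eval e [x] y}"
  unfolding W_def by (auto dest: code_inj)

text \<open>\<open>Mu\<close> searches for the witness and converges exactly on \<open>X\<close>.
  Since \<open>Q\<close> may read any entry of the environment, the environment is fixed to be
  constantly \<open>x\<close>.\<close>

lemma semidecidable_RE:
  assumes "semidecidable (\<lambda>s. s 0 \<in> X)" shows "RE X"
proof -
  from assms obtain Q where Q: "decidable (\<lambda>s. Q (s 0) (\<lambda>i. s (Suc i)))"
    "\<And>s :: nat \<Rightarrow> nat. s 0 \<in> X \<longleftrightarrow> (\<exists>t. Q t s)"
    by (rule semidecidableE) blast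
  have "decidable (\<lambda>s. \<not> Q (s 0) (\<lambda>_. s 1))"
    by (intro decidable_not decidable_subst_Suc[OF Q(1)] computable_var)
  then obtain e n where e: "\<And>s. eval e (map s [0..<n]) (of_bool (\<not> Q (s 0) (\<lambda>_. s 1)))"
    by (auto simp: decidable_def computable_def)
  \<comment> \<open>\<open>e\<close> expects \<open>n\<close> arguments; these projections supply
    the candidate witness at place \<open>0\<close> and \<open>x\<close> at all others.\<close>
  define e' where "e' = Comp e (map (\<lambda>i. Proj (min i 1)) [0..<n])"
  have e': "eval e' [t, x] (of_bool (\<not> Q t (\<lambda>_. x)))" for t x
  proof -
    let ?s = "case_nat t (\<lambda>_. x)"
    have "eval (Proj (min i 1)) [t, x] (?s i)" for i
      using eval.Proj[of "min i 1" "[t, x]"] by (cases i) auto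
    with eval.Comp[OF _ _ e[of ?s], of "map (\<lambda>i. Proj (min i 1)) [0..<n]" "[t, x]"]
    show ?thesis by (simp add: e'_def)
  qed
  have "x \<in> X \<longleftrightarrow> (\<exists>y. eval (Mu e') [x] y)" for x
  proof
    assume "x \<in> X"
    then have *: "\<exists>t. Q t (\<lambda>_. x)" using Q(2)[of "\<lambda>_. x"] by simp
    have "eval (Mu e') [x] (LEAST t. Q t (\<lambda>_. x))"
    proof (rule eval.Mu)
      show "eval e' [LEAST t. Q t (\<lambda>_. x), x] 0"
        using e'[of "LEAST t. Q t (\<lambda>_. x)" x] LeastI_ex[OF *] by simp
      show "\<forall>k<LEAST t. Q t (\<lambda>_. x). \<exists>y. eval e' [k, x] (Suc y)"
      proof (intro allI impI exI)
        fix k assume "k < (LEAST t. Q t (\<lambda>_. x))"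
        from not_less_Least[OF this] show "eval e' [k, x] (Suc 0)"
          using e'[of k x] by simp
      qed
    qed
    then show "\<exists>y. eval (Mu e') [x] y" ..
  next
    assume "\<exists>y. eval (Mu e') [x] y"
    then obtain y where "eval e' [y, x] 0" by (auto elim: eval_MuE)
    from eval_det[OF this e'] have "Q y (\<lambda>_. x)" by (auto simp: of_bool_def split: if_splits)
    with Q(2)[of "\<lambda>_. x"] show "x \<in> X" by auto
  qed
  then have "X = W (code (Mu e'))" by (auto simp: W_code simp del: code.simps)
  then show ?thesis unfolding RE_def ..
qed

section \<open>Coded sequences and derivations\<close>

definition entry :: "nat \<Rightarrow> nat \<Rightarrow> nat" where
  "entry c k = fst (prod_decode (((\<lambda>c. snd (prod_decode (c - 1))) ^^ k) c - 1))"

lemma entry_list_encode: "k < length xs \<Longrightarrow> entry (list_encode xs) k = xs ! k"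
proof (induction k arbitrary: xs)
  case 0
  then show ?case by (cases xs) (auto simp: entry_def)
next
  case (Suc k)
  then show ?case by (cases xs) (auto simp: entry_def funpow_Suc_right simp del: funpow.simps)
qed

text \<open>As \<open>entry\<close> is total, every number codes an infinite sequence and
  quantifying over codes needs no side condition. The \<open>c - 1\<close> in \<open>entry\<close>
  undoes the \<open>Suc\<close> of \<open>list_encode\<close>.\<close>

lemma ex_entry: "\<exists>c. \<forall>k<n. entry c k = f k"
  by (rule exI[of _ "list_encode (map f [0..<n])"]) (simp add: entry_list_encode)

lemma computable_entry:
  assumes "computable f" "computable g" shows "computable (\<lambda>s. entry (f s) (g s))"
proof -
  have "((\<lambda>c. snd (prod_decode (c - 1))) ^^ k) c = rec_nat c (\<lambda>_ c. snd (prod_decode (c - 1))) k"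
    for k c by (induction k) auto
  then show ?thesis unfolding entry_def
    by (simp only:) (intro computable_prod_decode computable_diff computable_rec_nat
        computable_const computable_var assms)
qed

lemma semidecidable_comp:
  assumes "semidecidable (\<lambda>s. P (s 0))" "computable f"
  shows "semidecidable (\<lambda>s. P (f s))"
  using semidecidable_subst[OF assms(1), of "\<lambda>i. f"] assms(2) by simp

lemma semidecidable_comp3:
  assumes "semidecidable (\<lambda>s. P (s 0) (s 1) (s 2))" "computable f" "computable g" "computable h"
  shows "semidecidable (\<lambda>s. P (f s) (g s) (h s))"
  using semidecidable_subst[OF assms(1), of "case_nat f (case_nat g (\<lambda>_. h))"] assms(2-4)
  by (simp add: numeral_2_eq_2 split: nat.split)

text \<open>The sets generated by rules with two premises; a single premise is given twice.\<close>

inductive generated :: "(nat \<Rightarrow> bool) \<Rightarrow> (nat \<Rightarrow> nat \<Rightarrow> nat \<Rightarrow> bool) \<Rightarrow> nat \<Rightarrow> bool"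
  for Ax Rule where
  base: "Ax x \<Longrightarrow> generated Ax Rule x"
| step: "generated Ax Rule y \<Longrightarrow> generated Ax Rule z \<Longrightarrow> Rule x y z \<Longrightarrow> generated Ax Rule x"

definition derivation ::
  "(nat \<Rightarrow> bool) \<Rightarrow> (nat \<Rightarrow> nat \<Rightarrow> nat \<Rightarrow> bool) \<Rightarrow> (nat \<Rightarrow> nat) \<Rightarrow> nat \<Rightarrow> bool" where
  "derivation Ax Rule f n \<longleftrightarrow>
    (\<forall>k<n. Ax (f k) \<or> (\<exists>i<k. \<exists>j<k. Rule (f k) (f i) (f j)))"

lemma derivation_generated:
  "derivation Ax Rule f n \<Longrightarrow> k < n \<Longrightarrow> generated Ax Rule (f k)"
proof (induction k rule: less_induct)
  case (less k)
  then consider "Ax (f k)" | i j where "i < k" "j < k" "Rule (f k) (f i) (f j)"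
    unfolding derivation_def by blast
  then show ?case
  proof cases
    case 2
    show ?thesis
      by (rule generated.step[of _ _ "f i" "f j"]) (use less 2 in auto)
  qed (rule generated.base)
qed

lemma derivation_append:
  assumes "derivation Ax Rule f m" "derivation Ax Rule g n"
  shows "derivation Ax Rule (\<lambda>k. if k < m then f k else g (k - m)) (m + n)"
  unfolding derivation_def
proof (intro allI impI)
  let ?h = "\<lambda>k. if k < m then f k else g (k - m)"
  fix k assume k: "k < m + n"
  show "Ax (?h k) \<or> (\<exists>i<k. \<exists>j<k. Rule (?h k) (?h i) (?h j))"
  proof (cases "k < m")
    case True
    with assms(1) consider "Ax (f k)" | i j where "i < k" "j < k" "Rule (f k) (f i) (f j)"
      unfolding derivation_def by blast
    then show ?thesis
    proof cases
      case 2
      with True show ?thesis by (intro disjI2 exI[of _ i] exI[of _ j] conjI) auto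
    qed (use True in simp)
  next
    case False
    with k have "k - m < n" by simp
    with assms(2) consider "Ax (g (k - m))"
      | i j where "i < k - m" "j < k - m" "Rule (g (k - m)) (g i) (g j)"
      unfolding derivation_def by blast
    then show ?thesis
    proof cases
      case 2
      with False show ?thesis
        by (intro disjI2 exI[of _ "m + i"] exI[of _ "m + j"] conjI) auto
    qed (use False in simp)
  qed
qed

text \<open>The derivations of the two premises are concatenated and the conclusion is appended; the
  premises then stand at positions \<open>m\<close> and \<open>Suc m + n\<close>.\<close>

lemma generated_derivation:
  "generated Ax Rule x \<Longrightarrow> \<exists>f n. derivation Ax Rule f (Suc n) \<and> f n = x"
proof (induction rule: generated.induct)
  case (base x)
  then show ?case by (intro exI[of _ "\<lambda>_. x"] exI[of _ 0]) (simp add: derivation_def)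
next
  case (step y z x)
  then obtain f m g n where fg: "derivation Ax Rule f (Suc m)" "f m = y"
    "derivation Ax Rule g (Suc n)" "g n = z" by blast
  define h where "h = (\<lambda>k. if k < Suc m then f k else g (k - Suc m))"
  define h' where "h' = h(Suc m + Suc n := x)"
  have h: "derivation Ax Rule h (Suc m + Suc n)"
    using derivation_append[OF fg(1,3)] by (simp add: h_def)
  have "h m = y" "h (Suc m + n) = z" by (auto simp: h_def fg)
  then have R: "Rule x (h m) (h (Suc m + n))" using step.hyps by simp
  have "Ax (h' k) \<or> (\<exists>i<k. \<exists>j<k. Rule (h' k) (h' i) (h' j))" if "k < Suc (Suc m + Suc n)" for k
  proof (cases "k = Suc m + Suc n")
    case True
    then show ?thesis using R
      by (intro disjI2 exI[of _ m] exI[of _ "Suc m + n"] conjI) (auto simp: h'_def)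
  next
    case False
    with that have k: "k < Suc m + Suc n" by simp
    with h consider "Ax (h k)" | i j where "i < k" "j < k" "Rule (h k) (h i) (h j)"
      unfolding derivation_def by blast
    then show ?thesis
    proof cases
      case 2
      with k show ?thesis
        by (intro disjI2 exI[of _ i] exI[of _ j] conjI) (auto simp: h'_def)
    qed (use k in \<open>auto simp: h'_def\<close>)
  qed
  then show ?case
    by (intro exI[of _ h'] exI[of _ "Suc m + Suc n"]) (auto simp: derivation_def h'_def)
qed

text \<open>A derivation is given by a code \<open>c\<close> and the position \<open>n\<close> of
  its last line. The remaining quantifiers are bounded, so generation is semidecidable as soon as
  \<open>Ax\<close> and \<open>Rule\<close> are.\<close>

lemma generated_iff_entry:
  "generated Ax Rule x \<longleftrightarrow> (\<exists>c n. entry c n = x \<and> derivation Ax Rule (entry c) (Suc n))"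
proof
  assume "generated Ax Rule x"
  from generated_derivation[OF this] obtain f n
    where f: "derivation Ax Rule f (Suc n)" "f n = x" by blast
  from ex_entry[of "Suc n" f] obtain c where c: "\<And>k. k < Suc n \<Longrightarrow> entry c k = f k" by blast
  have "derivation Ax Rule (entry c) (Suc n)"
    unfolding derivation_def
  proof (intro allI impI)
    fix k assume k: "k < Suc n"
    with f(1) consider "Ax (f k)" | i j where "i < k" "j < k" "Rule (f k) (f i) (f j)"
      unfolding derivation_def by blast
    then show "Ax (entry c k) \<or>
        (\<exists>i<k. \<exists>j<k. Rule (entry c k) (entry c i) (entry c j))"
    proof cases
      case 2
      with k c show ?thesis by (intro disjI2 exI[of _ i] exI[of _ j] conjI) auto
    qed (use c[OF k] in simp)
  qed
  with c[of n] f(2) show "\<exists>c n. entry c n = x \<and> derivation Ax Rule (entry c) (Suc n)" by auto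
next
  assume "\<exists>c n. entry c n = x \<and> derivation Ax Rule (entry c) (Suc n)"
  then obtain c n where "entry c n = x" "derivation Ax Rule (entry c) (Suc n)" by blast
  with derivation_generated[of Ax Rule "entry c" "Suc n" n] show "generated Ax Rule x" by simp
qed

lemma semidecidable_generated:
  assumes Ax: "semidecidable (\<lambda>s. Ax (s 0))"
    and Rule: "semidecidable (\<lambda>s. Rule (s 0) (s 1) (s 2))"
  shows "semidecidable (\<lambda>s. generated Ax Rule (s 0))"
  unfolding generated_iff_entry derivation_def
  by (intro semidecidable_ex semidecidable_conj semidecidable_ball semidecidable_disj
      semidecidable_bex semidecidable_comp[OF Ax] semidecidable_comp3[OF Rule]
      decidable_semidecidable decidable_eq computable_entry computable_var computable_Suc)

section \<open>RE sets are semidecidable\<close>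

lemma map_upt_Suc: "map f [0..<Suc n] = f 0 # map (\<lambda>i. f (Suc i)) [0..<n]"
  by (simp add: upt_conv_Cons map_Suc_upt[symmetric] comp_def del: upt_Suc)

text \<open>Coding the intermediate values turns a quantifier over lists into one over
  numbers.\<close>

lemma eval_Comp_iff:
  "eval (Comp f gs) xs y \<longleftrightarrow> (\<exists>c. (\<forall>i<length gs. eval (gs ! i) xs (entry c i)) \<and>
    eval f (map (\<lambda>i. entry c i) [0..<length gs]) y)"
proof
  assume "eval (Comp f gs) xs y"
  then obtain ys where ys: "length ys = length gs" "\<forall>i<length gs. eval (gs ! i) xs (ys ! i)"
    "eval f ys y" by (auto elim: eval_CompE)
  from ex_entry[of "length gs" "(!) ys"] obtain c where
    c: "\<And>i. i < length gs \<Longrightarrow> entry c i = ys ! i" by blast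
  have "map (\<lambda>i. entry c i) [0..<length gs] = ys"
    by (rule nth_equalityI) (auto simp: c ys(1))
  with ys c show "\<exists>c. (\<forall>i<length gs. eval (gs ! i) xs (entry c i)) \<and>
      eval f (map (\<lambda>i. entry c i) [0..<length gs]) y"
    by (intro exI[of _ c]) simp
next
  assume "\<exists>c. (\<forall>i<length gs. eval (gs ! i) xs (entry c i)) \<and>
    eval f (map (\<lambda>i. entry c i) [0..<length gs]) y"
  then obtain c where "\<forall>i<length gs. eval (gs ! i) xs (entry c i)"
    "eval f (map (\<lambda>i. entry c i) [0..<length gs]) y" by blast
  then show "eval (Comp f gs) xs y" by (intro eval.Comp[of "map (entry c) [0..<length gs]"]) simp_all
qed

text \<open>\<open>c\<close> codes the course of values, so that the recursion becomes a bounded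
  universal quantifier over its stages.\<close>

lemma eval_PRec_iff:
  "eval (PRec f g) (m # xs) y \<longleftrightarrow> (\<exists>c. eval f xs (entry c 0) \<and>
    (\<forall>k<m. eval g (k # entry c k # xs) (entry c (Suc k))) \<and> entry c m = y)"
proof
  have "\<exists>h. eval f xs (h 0) \<and> (\<forall>k<m. eval g (k # h k # xs) (h (Suc k))) \<and> h m = y"
    if "eval (PRec f g) (m # xs) y"
    using that
  proof (induction m arbitrary: y)
    case 0
    then show ?case by (auto elim: eval_PRec_0E)
  next
    case (Suc m)
    from Suc.prems obtain u where u: "eval (PRec f g) (m # xs) u" "eval g (m # u # xs) y"
      by (auto elim: eval_PRec_SucE)
    from Suc.IH[OF u(1)] obtain h where "eval f xs (h 0)"
      "\<forall>k<m. eval g (k # h k # xs) (h (Suc k))" "h m = u" by blast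
    with u(2) show ?case by (intro exI[of _ "h(Suc m := y)"]) (auto simp: less_Suc_eq)
  qed
  moreover assume "eval (PRec f g) (m # xs) y"
  ultimately obtain h where h: "eval f xs (h 0)"
    "\<forall>k<m. eval g (k # h k # xs) (h (Suc k))" "h m = y" by blast
  from ex_entry[of "Suc m" h] obtain c where "\<And>k. k < Suc m \<Longrightarrow> entry c k = h k" by blast
  with h show "\<exists>c. eval f xs (entry c 0) \<and>
    (\<forall>k<m. eval g (k # entry c k # xs) (entry c (Suc k))) \<and> entry c m = y"
    by (intro exI[of _ c]) simp
next
  assume "\<exists>c. eval f xs (entry c 0) \<and>
    (\<forall>k<m. eval g (k # entry c k # xs) (entry c (Suc k))) \<and> entry c m = y"
  then obtain c where c: "eval f xs (entry c 0)"
    "\<forall>k<m. eval g (k # entry c k # xs) (entry c (Suc k))" "entry c m = y" by blast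
  have "k \<le> m \<Longrightarrow> eval (PRec f g) (k # xs) (entry c k)" for k
    by (induction k) (use c in \<open>auto intro: eval.PRec_0 eval.PRec_Suc\<close>)
  with c(3) show "eval (PRec f g) (m # xs) y" by blast
qed

lemma eval_Mu_iff:
  "eval (Mu f) xs n \<longleftrightarrow> eval f (n # xs) 0 \<and> (\<forall>k<n. \<exists>y. eval f (k # xs) (Suc y))"
  by (auto elim: eval_MuE intro: eval.Mu)

text \<open>Induction on the program. The arguments are arbitrary computable functions of the
  environment because subprograms are run below quantifiers, on shifted arguments and on entries of
  coded sequences.\<close>

lemma semidecidable_eval:
  assumes "\<And>i. computable (G i)" "computable g"
  shows "semidecidable (\<lambda>s. eval e (map (\<lambda>i. G i s) [0..<n]) (g s))"
  using assms
proof (induction e arbitrary: n G g)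
  case Zero
  have "eval Zero xs y \<longleftrightarrow> y = 0" for xs y by (auto elim: eval_ZeroE intro: eval.Zero)
  then show ?case
    by (auto intro!: decidable_semidecidable decidable_eq Zero computable_const)
next
  case Succ
  have "eval Succ (map (\<lambda>i. G i s) [0..<n]) y \<longleftrightarrow> n = 1 \<and> y = Suc (G 0 s)" for s y
  proof
    assume *: "eval Succ (map (\<lambda>i. G i s) [0..<n]) y"
    then obtain x where x: "map (\<lambda>i. G i s) [0..<n] = [x]" "y = Suc x" by (auto elim: eval_SuccE)
    then have "length (map (\<lambda>i. G i s) [0..<n]) = 1" by simp
    then have "n = 1" by simp
    with x show "n = 1 \<and> y = Suc (G 0 s)" by simp
  qed (auto intro: eval.Succ)
  then show ?case
    by (simp only:) (intro decidable_semidecidable decidable_conj decidable_const decidable_eq Succ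
        computable_Suc)
next
  case (Proj j)
  have "eval (Proj j) (map (\<lambda>i. G i s) [0..<n]) y \<longleftrightarrow> j < n \<and> y = G j s" for s y
    using eval.Proj[of j "map (\<lambda>i. G i s) [0..<n]"] by (auto elim: eval_ProjE)
  then show ?case
    by (simp only:) (intro decidable_semidecidable decidable_conj decidable_const decidable_eq Proj)
next
  case (Comp f gs)
  have "computable (\<lambda>s. G i (\<lambda>i. s (Suc i)))" for i
    using computable_shift[OF Comp.prems(1)[of i], of 1] by simp
  moreover have "computable (\<lambda>s. g (\<lambda>i. s (Suc i)))"
    using computable_shift[OF Comp.prems(2), of 1] by simp
  ultimately show ?case unfolding eval_Comp_iff
    by (intro semidecidable_ex semidecidable_conj semidecidable_ball_const Comp.IH nth_mem
        computable_entry computable_var computable_const)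
next
  case (PRec f g')
  show ?case
  proof (cases n)
    case 0
    have "\<not> eval (PRec f g') [] y" for y by (auto elim: eval.cases)
    with 0 show ?thesis by (simp add: decidable_semidecidable decidable_const)
  next
    case (Suc m)
    have G1: "computable (\<lambda>s. G i (\<lambda>i. s (Suc i)))" for i
      using computable_shift[OF PRec.prems(1)[of i], of 1] by simp
    have G2: "computable (\<lambda>s. G i (\<lambda>i. s (Suc (Suc i))))" for i
      using computable_shift[OF PRec.prems(1)[of i], of 2] by simp
    have g1: "computable (\<lambda>s. g (\<lambda>i. s (Suc i)))"
      using computable_shift[OF PRec.prems(2), of 1] by simp
    \<comment> \<open>Here \<open>s 0\<close> is the stage and \<open>s 1\<close> the code of the
      values. The parameters start at \<open>G 1\<close>, as \<open>G 0\<close> is the recursion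
      argument.\<close>
    let ?H = "case_nat (\<lambda>s. s 0) (case_nat (\<lambda>s. entry (s (Suc 0)) (s 0))
      (\<lambda>i s. G (Suc i) (\<lambda>i. s (Suc (Suc i)))))"
    have "s 0 # entry (s (Suc 0)) (s 0) # map (\<lambda>i. G (Suc i) (\<lambda>i. s (Suc (Suc i)))) [0..<m] =
        map (\<lambda>i. ?H i s) [0..<Suc (Suc m)]" for s
      unfolding map_upt_Suc by simp
    moreover have "computable (?H i)" for i
      using G2 by (auto intro: computable_var computable_entry split: nat.split)
    ultimately have step: "semidecidable (\<lambda>s. eval g'
        (s 0 # entry (s (Suc 0)) (s 0) # map (\<lambda>i. G (Suc i) (\<lambda>i. s (Suc (Suc i)))) [0..<m])
        (entry (s (Suc 0)) (Suc (s 0))))"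
      by (simp only:) (intro PRec.IH computable_entry computable_Suc computable_var)
    show ?thesis unfolding Suc map_upt_Suc eval_PRec_iff
      by (intro semidecidable_ex semidecidable_conj semidecidable_ball step PRec.IH(1) G1 g1
          decidable_semidecidable decidable_eq computable_entry computable_var computable_const)
  qed
next
  case (Mu f)
  have G1: "computable (\<lambda>s. G i (\<lambda>i. s (Suc i)))" for i
    using computable_shift[OF Mu.prems(1)[of i], of 1] by simp
  have G2: "computable (\<lambda>s. G i (\<lambda>i. s (Suc (Suc i))))" for i
    using computable_shift[OF Mu.prems(1)[of i], of 2] by simp
  let ?H = "case_nat g G"
  \<comment> \<open>Here \<open>s 1\<close> is the argument below the least zero, and
    \<open>s 0\<close> is the predecessor of the value there.\<close>
  let ?H' = "case_nat (\<lambda>s. s (Suc 0)) (\<lambda>i s. G i (\<lambda>i. s (Suc (Suc i))))"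
  have H: "g s # map (\<lambda>i. G i s) [0..<n] = map (\<lambda>i. ?H i s) [0..<Suc n]" for s
    unfolding map_upt_Suc by simp
  have 1: "semidecidable (\<lambda>s. eval f (g s # map (\<lambda>i. G i s) [0..<n]) 0)"
    unfolding H by (rule Mu.IH) (auto intro: Mu.prems computable_const split: nat.split)
  have H': "s (Suc 0) # map (\<lambda>i. G i (\<lambda>i. s (Suc (Suc i)))) [0..<n] =
      map (\<lambda>i. ?H' i s) [0..<Suc n]" for s
    unfolding map_upt_Suc by simp
  have 2: "semidecidable (\<lambda>s. eval f (s (Suc 0) # map (\<lambda>i. G i (\<lambda>i. s (Suc (Suc i)))) [0..<n])
      (Suc (s 0)))"
    unfolding H' by (rule Mu.IH)
      (auto intro: G2 computable_var computable_Suc split: nat.split)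
  show ?case unfolding eval_Mu_iff
    by (intro semidecidable_conj semidecidable_ball semidecidable_ex 1 2 Mu.prems)
qed

lemma RE_semidecidable:
  assumes "RE X" "computable f" shows "semidecidable (\<lambda>s. f s \<in> X)"
proof -
  from assms(1) obtain i where X: "X = W i" by (auto simp: RE_def)
  show ?thesis
  proof (cases "\<exists>e. i = code e")
    case True
    then obtain e where "X = {x. \<exists>y. eval e [x] y}" using X W_code by auto
    moreover have "semidecidable (\<lambda>s. \<exists>y. eval e (map (\<lambda>i. s 0) [0..<1]) y)"
      by (intro semidecidable_ex semidecidable_eval computable_var)
    ultimately show ?thesis
      using semidecidable_comp[OF _ assms(2), of "\<lambda>x. x \<in> X"] by simp
  next
    case False
    then have "X = {}" using X by (auto simp: W_def)
    then show ?thesis by (simp add: decidable_semidecidable decidable_const)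
  qed
qed

text \<open>Determinism turns convergence to \<open>y\<close> into the equivalence that
  \<open>recursive_set\<close> and \<open>recursive_fun2\<close> ask for.\<close>

lemma eval_iff: "eval e xs y \<Longrightarrow> eval e xs v \<longleftrightarrow> v = y"
  using eval_det by blast

lemma computable_unary:
  assumes "computable (\<lambda>s. h (s 0))" shows "\<exists>e. \<forall>x. eval e [x] (h x)"
proof -
  from assms obtain e n where e: "\<And>s. eval e (map s [0..<n]) (h (s 0))"
    unfolding computable_def by blast
  have "eval (Comp e (map (\<lambda>i. Proj 0) [0..<n])) [x] (h x)" for x
    using eval.Proj[of 0 "[x]"] by (intro eval.Comp[OF _ _ e[of "\<lambda>_. x"]]) auto
  then show ?thesis by blast
qed

lemma recursive_set_iff: "recursive_set Z \<longleftrightarrow> decidable (\<lambda>s. s 0 \<in> Z)"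
proof
  assume "recursive_set Z"
  then obtain e where "\<And>x. eval e [x] (if x \<in> Z then 1 else 0)" unfolding recursive_set_def by blast
  then have "eval e (map s [0..<1]) (of_bool (s 0 \<in> Z))" for s by (simp add: of_bool_def)
  then show "decidable (\<lambda>s. s 0 \<in> Z)" unfolding decidable_def computable_def by blast
next
  assume "decidable (\<lambda>s. s 0 \<in> Z)"
  then obtain e where e: "\<And>x. eval e [x] (of_bool (x \<in> Z))"
    unfolding decidable_def using computable_unary[of "\<lambda>x. of_bool (x \<in> Z)"] by blast
  show "recursive_set Z" unfolding recursive_set_def
    by (intro exI[of _ e]) (simp add: eval_iff[OF e] of_bool_def)
qed

lemma recursive_fun2_iff: "recursive_fun2 f \<longleftrightarrow> computable (\<lambda>s. f (s 0) (s 1))"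
proof
  assume "recursive_fun2 f"
  then obtain e where "\<And>x y. eval e [x, y] (f x y)" unfolding recursive_fun2_def by blast
  then have "eval e (map s [0..<2]) (f (s 0) (s 1))" for s by (simp add: upt_rec numeral_2_eq_2)
  then show "computable (\<lambda>s. f (s 0) (s 1))" unfolding computable_def by blast
next
  assume "computable (\<lambda>s. f (s 0) (s 1))"
  then obtain e n where e: "\<And>s. eval e (map s [0..<n]) (f (s 0) (s 1))"
    unfolding computable_def by blast
  have *: "eval (Comp e (map (\<lambda>i. Proj (min i 1)) [0..<n])) [x, y] (f x y)" for x y
  proof -
    have "eval (Proj (min i 1)) [x, y] (case_nat x (\<lambda>_. y) i)" for i
      using eval.Proj[of "min i 1" "[x, y]"] by (cases i) auto
    with eval.Comp[OF _ _ e[of "case_nat x (\<lambda>_. y)"], of "map (\<lambda>i. Proj (min i 1)) [0..<n]" "[x, y]"]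
    show ?thesis by simp
  qed
  show "recursive_fun2 f" unfolding recursive_fun2_def using eval_iff[OF *] by blast
qed

section \<open>Arithmetisation of the calculus\<close>

lemma gn_inj: "gn \<phi> = gn \<psi> \<Longrightarrow> \<phi> = \<psi>"
  by (induction \<phi> arbitrary: \<psi>; case_tac \<psi>; simp)

lemma gn_eq_iff [simp]: "gn \<phi> = gn \<psi> \<longleftrightarrow> \<phi> = \<psi>"
  by (auto dest: gn_inj)

lemma computable_if:
  assumes "decidable P" "computable f" "computable g"
  shows "computable (\<lambda>s. if P s then f s else g s)"
proof -
  have "(if P s then f s else g s) = of_bool (P s) * f s + of_bool (\<not> P s) * g s" for s
    by simp
  then show ?thesis
    using assms decidable_not[OF assms(1)]
    by (simp only: decidable_def) (intro computable_add computable_mult; assumption)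
qed

lemmas computable_intros = computable_prod_encode computable_add computable_diff computable_Suc
  computable_const computable_var

lemmas semidecidable_intros = semidecidable_ex semidecidable_conj semidecidable_disj
  decidable_semidecidable[OF decidable_eq] decidable_semidecidable[OF decidable_less]

section \<open>Goedel numbers of the axioms\<close>

lemma computable_gn:
  "computable f \<Longrightarrow> computable g \<Longrightarrow> computable (\<lambda>s. gn (Eq (f s) (g s)))"
  "computable f \<Longrightarrow> computable g \<Longrightarrow> computable (\<lambda>s. gn (E (f s) (g s)))"
  "computable (\<lambda>s. gn (\<phi> s)) \<Longrightarrow> computable (\<lambda>s. gn (Neg (\<phi> s)))"
  "computable (\<lambda>s. gn (\<phi> s)) \<Longrightarrow> computable (\<lambda>s. gn (\<psi> s)) \<Longrightarrow> computable (\<lambda>s. gn (Imp (\<phi> s) (\<psi> s)))"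
  "computable (\<lambda>s. gn (\<phi> s)) \<Longrightarrow> computable (\<lambda>s. gn (All (\<phi> s)))"
  unfolding gn.simps by (intro computable_intros; assumption)+

text \<open>The number of quantifiers varies with the environment, so the Goedel number is computed
  by recursion on it; the tags 2, 4, 2 are those of \<open>Neg\<close>, \<open>All\<close>,
  \<open>Neg\<close>.\<close>

lemma computable_gn_Ex_pow:
  assumes "computable (\<lambda>s. gn (\<phi> s))" "computable n"
  shows "computable (\<lambda>s. gn ((Ex ^^ n s) (\<phi> s)))"
proof -
  have "gn ((Ex ^^ n) \<phi>) =
      rec_nat (gn \<phi>) (\<lambda>_ y. prod_encode (2, prod_encode (4, prod_encode (2, y)))) n" for n \<phi>
    by (induction n) auto
  then show ?thesis
    by (simp only:) (intro computable_rec_nat computable_intros assms)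
qed

lemma computable_gn_conj_below:
  assumes \<phi>: "computable (\<lambda>s. gn (\<phi> (s 0) (\<lambda>i. s (Suc i))))" and n: "computable n"
  shows "computable (\<lambda>s. gn (conj_below (n s) (\<lambda>i. \<phi> i s)))"
proof -
  have "gn (conj_below n f) = rec_nat (gn (All (Eq 0 0)))
      (\<lambda>k y. prod_encode (2, prod_encode (3, prod_encode (y, prod_encode (2, gn (f k)))))) n" for n f
    by (induction n) auto
  moreover have "computable (\<lambda>s. gn (\<phi> (s 0) (\<lambda>i. s (Suc (Suc i)))))"
    using computable_subst[OF \<phi>, of "case_nat (\<lambda>s. s 0) (\<lambda>i s. s (Suc (Suc i)))"]
    by (simp add: computable_var split: nat.split)
  ultimately show ?thesis
    by (simp only:) (intro computable_rec_nat computable_intros n)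
qed

lemma computable_gn_class_at_least:
  assumes "computable f" "computable g"
  shows "computable (\<lambda>s. gn (class_at_least (f s) (g s)))"
proof (rule computable_comp2[OF _ assms])
  show "computable (\<lambda>s. gn (class_at_least (s 0) (s 1)))"
    unfolding class_at_least_def
    by (intro computable_gn_Ex_pow computable_gn_conj_below computable_gn computable_intros)
qed

lemma computable_gn_class_exactly:
  assumes "computable f" "computable g"
  shows "computable (\<lambda>s. gn (class_exactly (f s) (g s)))"
  unfolding class_exactly_def
  by (intro computable_gn_class_at_least computable_gn computable_intros assms)

lemma computable_gn_at_most_one_class: "computable (\<lambda>s. gn (at_most_one_class (s 0)))"
  unfolding at_most_one_class_def
  by (intro computable_gn_class_exactly computable_gn computable_intros)

lemma computable_gn_many_large_classes: "computable (\<lambda>s. gn (many_large_classes (s 0)))"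
  unfolding many_large_classes_def
  by (intro computable_gn_class_at_least computable_gn_Ex_pow computable_gn_conj_below
      computable_gn computable_intros)

lemma computable_gn_A: "computable (\<lambda>s. gn (A (s 0)))"
  unfolding A_def
  by (intro computable_gn_class_exactly computable_gn computable_intros)

section \<open>Formulas and sentences as generated sets\<close>

definition fv_axiom :: "nat \<Rightarrow> bool" where
  "fv_axiom x \<longleftrightarrow> (\<exists>d i j. i < d \<and> j < d \<and>
    (x = prod_encode (d, prod_encode (0, prod_encode (i, j))) \<or>
     x = prod_encode (d, prod_encode (1, prod_encode (i, j)))))"

definition fv_rule :: "nat \<Rightarrow> nat \<Rightarrow> nat \<Rightarrow> bool" where
  "fv_rule x y z \<longleftrightarrow> (\<exists>d a b.
    y = prod_encode (d, a) \<and> z = prod_encode (d, b) \<and>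
      x = prod_encode (d, prod_encode (3, prod_encode (a, b))) \<or>
    y = prod_encode (d, a) \<and> x = prod_encode (d, prod_encode (2, a)) \<or>
    y = prod_encode (Suc d, a) \<and> x = prod_encode (d, prod_encode (4, a)))"

lemma fv_All_subset_iff: "fv (All \<phi>) \<subseteq> {..<d} \<longleftrightarrow> fv \<phi> \<subseteq> {..<Suc d}"
proof
  assume *: "fv (All \<phi>) \<subseteq> {..<d}"
  show "fv \<phi> \<subseteq> {..<Suc d}"
  proof
    fix k assume "k \<in> fv \<phi>"
    with * show "k \<in> {..<Suc d}" by (cases k) auto
  qed
qed auto

text \<open>The bound \<open>d\<close> travels with the formula because it drops by one when a
  quantifier is added. Bound \<open>0\<close> singles out the sentences, and every formula has some
  bound.\<close>

lemma generated_fv_iff: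
  "generated fv_axiom fv_rule x \<longleftrightarrow> (\<exists>d \<phi>. x = prod_encode (d, gn \<phi>) \<and> fv \<phi> \<subseteq> {..<d})"
proof
  assume "generated fv_axiom fv_rule x"
  then show "\<exists>d \<phi>. x = prod_encode (d, gn \<phi>) \<and> fv \<phi> \<subseteq> {..<d}"
  proof induction
    case (base x)
    then obtain d i j where "i < d" "j < d"
      "x = prod_encode (d, gn (Eq i j)) \<or> x = prod_encode (d, gn (E i j))"
      unfolding fv_axiom_def gn.simps by blast
    then show ?case by (metis fv.simps(1,2) insert_subset empty_subsetI lessThan_iff)
  next
    case (step y z x)
    then obtain d \<phi> d' \<psi> where y: "y = prod_encode (d, gn \<phi>)" "fv \<phi> \<subseteq> {..<d}"
      and z: "z = prod_encode (d', gn \<psi>)" "fv \<psi> \<subseteq> {..<d'}" by blast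
    from step.hyps(3) y(1) z(1) consider
      "d' = d" "x = prod_encode (d, gn (Imp \<phi> \<psi>))" | "x = prod_encode (d, gn (Neg \<phi>))"
      | n where "d = Suc n" "x = prod_encode (n, gn (All \<phi>))"
      unfolding fv_rule_def by auto
    then show ?case
    proof cases
      case 1
      with y(2) z(2) show ?thesis by (intro exI[of _ d] exI[of _ "Imp \<phi> \<psi>"]) simp
    next
      case 2
      with y(2) show ?thesis by (intro exI[of _ d] exI[of _ "Neg \<phi>"]) simp
    next
      case 3
      with y(2) show ?thesis
        by (intro exI[of _ n] exI[of _ "All \<phi>"]) (simp add: fv_All_subset_iff del: fv.simps)
    qed
  qed
next
  have "fv \<phi> \<subseteq> {..<d} \<Longrightarrow> generated fv_axiom fv_rule (prod_encode (d, gn \<phi>))" for d \<phi>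
  proof (induction \<phi> arbitrary: d)
    case (Eq i j)
    then show ?case by (intro generated.base) (auto simp: fv_axiom_def)
  next
    case (E i j)
    then show ?case by (intro generated.base) (auto simp: fv_axiom_def)
  next
    case (Neg \<phi>)
    then have *: "generated fv_axiom fv_rule (prod_encode (d, gn \<phi>))" by simp
    show ?case by (rule generated.step[OF * *]) (simp add: fv_rule_def)
  next
    case (Imp \<phi> \<psi>)
    then have *: "generated fv_axiom fv_rule (prod_encode (d, gn \<phi>))"
      "generated fv_axiom fv_rule (prod_encode (d, gn \<psi>))" by auto
    show ?case by (rule generated.step[OF *]) (simp add: fv_rule_def)
  next
    case (All \<phi>)
    then have *: "generated fv_axiom fv_rule (prod_encode (Suc d, gn \<phi>))"
      by (simp only: fv_All_subset_iff)
    show ?case by (rule generated.step[OF * *]) (simp add: fv_rule_def)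
  qed
  then show "\<exists>d \<phi>. x = prod_encode (d, gn \<phi>) \<and> fv \<phi> \<subseteq> {..<d} \<Longrightarrow>
    generated fv_axiom fv_rule x" by blast
qed

lemma semidecidable_fv: "semidecidable (\<lambda>s. generated fv_axiom fv_rule (s 0))"
  unfolding fv_axiom_def fv_rule_def
  by (intro semidecidable_generated semidecidable_intros computable_intros)

lemma finite_fv: "finite (fv \<phi>)"
proof (induction \<phi>)
  case (All \<phi>)
  then have "finite (Suc -` fv \<phi>)" by (intro finite_vimageI) auto
  then show ?case by (simp add: vimage_def)
qed auto

lemma semidecidable_formula:
  assumes "computable f" shows "semidecidable (\<lambda>s. f s \<in> range gn)"
proof (rule semidecidable_comp[OF _ assms])
  have "x \<in> range gn \<longleftrightarrow> (\<exists>d. generated fv_axiom fv_rule (prod_encode (d, x)))" for x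
  proof
    assume "x \<in> range gn"
    then obtain \<phi> where \<phi>: "x = gn \<phi>" by blast
    from finite_fv[of \<phi>] obtain d where "fv \<phi> \<subseteq> {..<d}" unfolding finite_nat_set_iff_bounded by auto
    with \<phi> show "\<exists>d. generated fv_axiom fv_rule (prod_encode (d, x))"
      unfolding generated_fv_iff by blast
  qed (auto simp: generated_fv_iff)
  then show "semidecidable (\<lambda>s. s 0 \<in> range gn)"
    by (simp only:) (intro semidecidable_ex semidecidable_comp[OF semidecidable_fv] computable_intros)
qed

lemma semidecidable_sentence:
  assumes "computable f" shows "semidecidable (\<lambda>s. f s \<in> gn ` Collect sentence)"
proof (rule semidecidable_comp[OF _ assms])
  have "x \<in> gn ` Collect sentence \<longleftrightarrow> generated fv_axiom fv_rule (prod_encode (0, x))" for x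
    by (auto simp: generated_fv_iff sentence_def)
  then show "semidecidable (\<lambda>s. s 0 \<in> gn ` Collect sentence)"
    by (simp only:) (intro semidecidable_comp[OF semidecidable_fv] computable_intros)
qed

text \<open>\<open>lift h d\<close> is the family of renamings \<open>h\<close> below \<open>d\<close> quantifiers.\<close>

definition lift :: "(nat \<Rightarrow> nat \<Rightarrow> nat) \<Rightarrow> nat \<Rightarrow> nat \<Rightarrow> nat \<Rightarrow> nat" where
  "lift h d p k = (if k < d then k else d + h p (k - d))"

lemma lift_0: "lift h 0 p = h p"
  by (auto simp: lift_def)

lemma lift_Suc: "(\<lambda>k. case k of 0 \<Rightarrow> 0 | Suc j \<Rightarrow> Suc (lift h d p j)) = lift h (Suc d) p"
  by (auto simp: lift_def split: nat.split)

text \<open>The tuples consist of a parameter, a depth, a formula and its renamed form. Renaming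
  changes below quantifiers, so its graph is generated for all depths at once; the parameter is
  carried along unchanged.\<close>

definition ren_axiom :: "(nat \<Rightarrow> nat \<Rightarrow> nat) \<Rightarrow> nat \<Rightarrow> bool" where
  "ren_axiom h x \<longleftrightarrow> (\<exists>p d i j.
    x = prod_encode (p, prod_encode (d, prod_encode (prod_encode (0, prod_encode (i, j)),
      prod_encode (0, prod_encode (lift h d p i, lift h d p j))))) \<or>
    x = prod_encode (p, prod_encode (d, prod_encode (prod_encode (1, prod_encode (i, j)),
      prod_encode (1, prod_encode (lift h d p i, lift h d p j))))))"

definition ren_rule :: "nat \<Rightarrow> nat \<Rightarrow> nat \<Rightarrow> bool" where
  "ren_rule x y z \<longleftrightarrow> (\<exists>p d a a' b b'.
    y = prod_encode (p, prod_encode (d, prod_encode (a, a'))) \<and>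
    z = prod_encode (p, prod_encode (d, prod_encode (b, b'))) \<and>
    x = prod_encode (p, prod_encode (d, prod_encode (prod_encode (3, prod_encode (a, b)),
      prod_encode (3, prod_encode (a', b'))))) \<or>
    y = prod_encode (p, prod_encode (d, prod_encode (a, a'))) \<and>
    x = prod_encode (p, prod_encode (d, prod_encode (prod_encode (2, a), prod_encode (2, a')))) \<or>
    y = prod_encode (p, prod_encode (Suc d, prod_encode (a, a'))) \<and>
    x = prod_encode (p, prod_encode (d, prod_encode (prod_encode (4, a), prod_encode (4, a')))))"

lemma generated_ren_iff:
  "generated (ren_axiom h) ren_rule x \<longleftrightarrow>
    (\<exists>p d \<phi>. x = prod_encode (p, prod_encode (d, prod_encode (gn \<phi>, gn (ren (lift h d p) \<phi>)))))"
proof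
  assume "generated (ren_axiom h) ren_rule x"
  then show "\<exists>p d \<phi>. x =
    prod_encode (p, prod_encode (d, prod_encode (gn \<phi>, gn (ren (lift h d p) \<phi>))))"
  proof induction
    case (base x)
    then obtain p d i j where
      "x = prod_encode (p, prod_encode (d, prod_encode (gn (Eq i j), gn (ren (lift h d p) (Eq i j))))) \<or>
       x = prod_encode (p, prod_encode (d, prod_encode (gn (E i j), gn (ren (lift h d p) (E i j)))))"
      unfolding ren_axiom_def ren.simps gn.simps by blast
    then show ?case by blast
  next
    case (step y z x)
    then obtain p d \<phi> p' d' \<psi> where
      y: "y = prod_encode (p, prod_encode (d, prod_encode (gn \<phi>, gn (ren (lift h d p) \<phi>))))" and
      z: "z = prod_encode (p', prod_encode (d', prod_encode (gn \<psi>, gn (ren (lift h d' p') \<psi>))))"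
      by blast
    define tuple where "tuple p d \<phi> =
      prod_encode (p, prod_encode (d, prod_encode (gn \<phi>, gn (ren (lift h d p) \<phi>))))" for p d \<phi>
    from step.hyps(3) y z have
      "x = tuple p d (Imp \<phi> \<psi>) \<or> x = tuple p d (Neg \<phi>) \<or> (\<exists>n. x = tuple p n (All \<phi>))"
      unfolding ren_rule_def tuple_def by (auto simp: lift_Suc)
    then show ?case unfolding tuple_def by blast
  qed
next
  have "generated (ren_axiom h) ren_rule
    (prod_encode (p, prod_encode (d, prod_encode (gn \<phi>, gn (ren (lift h d p) \<phi>)))))" for p d \<phi>
  proof (induction \<phi> arbitrary: d)
    case (Eq i j)
    then show ?case by (intro generated.base) (auto simp: ren_axiom_def)
  next
    case (E i j)
    then show ?case by (intro generated.base) (auto simp: ren_axiom_def)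
  next
    case (Neg \<phi>)
    show ?case by (rule generated.step[OF Neg Neg]) (simp add: ren_rule_def)
  next
    case (Imp \<phi> \<psi>)
    show ?case by (rule generated.step[OF Imp]) (simp add: ren_rule_def)
  next
    case (All \<phi>)
    show ?case by (rule generated.step[OF All[of "Suc d"] All[of "Suc d"]]) (simp add: ren_rule_def lift_Suc)
  qed
  then show "\<exists>p d \<phi>. x = prod_encode (p, prod_encode (d, prod_encode (gn \<phi>, gn (ren (lift h d p) \<phi>))))
    \<Longrightarrow> generated (ren_axiom h) ren_rule x" by blast
qed

text \<open>Depth \<open>0\<close> is the renaming itself. The parameter makes instantiation uniform
  in the variable that is put in.\<close>

lemma semidecidable_ren:
  assumes h: "computable (\<lambda>s. h (s 0) (s 1))" and "computable p" "computable f" "computable g"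
  shows "semidecidable (\<lambda>s. \<exists>\<phi>. f s = gn \<phi> \<and> g s = gn (ren (h (p s)) \<phi>))"
proof (rule semidecidable_comp3[where P = "\<lambda>p a b. \<exists>\<phi>. a = gn \<phi> \<and> b = gn (ren (h p) \<phi>)"])
  have *: "(\<exists>\<phi>. a = gn \<phi> \<and> b = gn (ren (h p) \<phi>)) \<longleftrightarrow>
    generated (ren_axiom h) ren_rule (prod_encode (p, prod_encode (0, prod_encode (a, b))))" for p a b
    by (auto simp: generated_ren_iff lift_0)
  show "semidecidable (\<lambda>s. \<exists>\<phi>. s 1 = gn \<phi> \<and> s 2 = gn (ren (h (s 0)) \<phi>))"
    unfolding * ren_axiom_def ren_rule_def lift_def
    by (intro semidecidable_comp[OF semidecidable_generated] semidecidable_intros computable_intros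
        computable_if decidable_less computable_comp2[OF h])
qed (use assms in auto)

lemma semidecidable_inst:
  assumes "computable m" "computable f" "computable g"
  shows "semidecidable (\<lambda>s. \<exists>\<phi>. f s = gn \<phi> \<and> g s = gn (inst \<phi> (m s)))"
proof -
  have "(case k of 0 \<Rightarrow> m | Suc j \<Rightarrow> j) = rec_nat m (\<lambda>j _. j) k" for k m :: nat
    by (cases k) auto
  then have "computable (\<lambda>s. case s 1 of 0 \<Rightarrow> s 0 | Suc j \<Rightarrow> j)"
    by (simp only:) (intro computable_rec_nat computable_intros)
  from semidecidable_ren[OF this assms] show ?thesis by (simp only: inst_def)
qed

lemma semidecidable_ren_Suc:
  assumes "computable f" "computable g"
  shows "semidecidable (\<lambda>s. \<exists>\<phi>. f s = gn \<phi> \<and> g s = gn (ren Suc \<phi>))"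
proof -
  have "computable (\<lambda>s. (\<lambda>_. Suc) (s 0) (s 1))" by (intro computable_intros)
  from semidecidable_ren[OF this computable_const assms] show ?thesis by simp
qed

section \<open>Provability\<close>

definition proof_axiom :: "fm set \<Rightarrow> nat \<Rightarrow> bool" where
  "proof_axiom T x \<longleftrightarrow> x \<in> gn ` T \<or>
    (\<exists>\<phi> \<psi>. x = gn (Imp \<phi> (Imp \<psi> \<phi>))) \<or>
    (\<exists>\<phi> \<psi> \<chi>. x = gn (Imp (Imp \<phi> (Imp \<psi> \<chi>)) (Imp (Imp \<phi> \<psi>) (Imp \<phi> \<chi>)))) \<or>
    (\<exists>\<phi> \<psi>. x = gn (Imp (Imp (Neg \<phi>) (Neg \<psi>)) (Imp \<psi> \<phi>))) \<or>
    (\<exists>m \<phi>. x = gn (Imp (All \<phi>) (inst \<phi> m))) \<or>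
    (\<exists>\<phi> \<psi>. x = gn (Imp (All (Imp \<phi> \<psi>)) (Imp (All \<phi>) (All \<psi>)))) \<or>
    (\<exists>\<phi>. x = gn (Imp \<phi> (All (ren Suc \<phi>)))) \<or>
    (\<exists>m. x = gn (Eq m m)) \<or>
    (\<exists>m n \<phi>. x = gn (Imp (Eq m n) (Imp (inst \<phi> m) (inst \<phi> n))))"

definition proof_rule :: "nat \<Rightarrow> nat \<Rightarrow> nat \<Rightarrow> bool" where
  "proof_rule x y z \<longleftrightarrow> y = prod_encode (3, prod_encode (z, x)) \<or> x = prod_encode (4, y)"

text \<open>\<open>proof_rule\<close> relates arbitrary numbers. The conclusion of modus ponens is a
  part of the major premise, and so it is the code of a formula once the major premise is.\<close>

lemma prod_encode_3_gn: "gn \<phi> = prod_encode (3, prod_encode (gn \<psi>, x)) \<longleftrightarrow> (\<exists>\<chi>. \<phi> = Imp \<psi> \<chi> \<and> x = gn \<chi>)"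
  by (cases \<phi>) auto

lemma generated_proof_iff:
  "generated (proof_axiom T) proof_rule x \<longleftrightarrow> (\<exists>\<phi>. x = gn \<phi> \<and> T \<turnstile> \<phi>)"
proof
  assume "generated (proof_axiom T) proof_rule x"
  then show "\<exists>\<phi>. x = gn \<phi> \<and> T \<turnstile> \<phi>"
  proof induction
    case (base x)
    then show ?case unfolding proof_axiom_def
      by (auto intro: proves.Axiom proves.K proves.S proves.Contrapos proves.Inst proves.Distrib
          proves.Vacuous proves.Eq_refl proves.Eq_subst simp del: gn.simps)
  next
    case (step y z x)
    then obtain \<phi> \<psi> where y: "y = gn \<phi>" "T \<turnstile> \<phi>" and z: "z = gn \<psi>" "T \<turnstile> \<psi>" by blast
    from step.hyps(3) show ?case unfolding proof_rule_def
    proof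
      assume "y = prod_encode (3, prod_encode (z, x))"
      with y(1) z(1) have "gn \<phi> = prod_encode (3, prod_encode (gn \<psi>, x))" by simp
      then obtain \<chi> where "\<phi> = Imp \<psi> \<chi>" "x = gn \<chi>" unfolding prod_encode_3_gn by blast
      with y(2) z(2) show ?case by (blast intro: proves.MP)
    next
      assume "x = prod_encode (4, y)"
      with y show ?case by (intro exI[of _ "All \<phi>"]) (simp add: proves.Gen)
    qed
  qed
next
  assume "\<exists>\<phi>. x = gn \<phi> \<and> T \<turnstile> \<phi>"
  then obtain \<phi> where x: "x = gn \<phi>" and "T \<turnstile> \<phi>" by blast
  from this(2) have "generated (proof_axiom T) proof_rule (gn \<phi>)"
  proof induction
    case (MP \<phi> \<psi>)
    show ?case by (rule generated.step[OF MP.IH]) (simp add: proof_rule_def)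
  next
    case (Gen \<phi>)
    show ?case by (rule generated.step[OF Gen.IH Gen.IH]) (simp add: proof_rule_def)
  qed (rule generated.base, force simp: proof_axiom_def simp del: gn.simps)+
  with x show "generated (proof_axiom T) proof_rule x" by simp
qed

lemma semidecidable_proof_axiom:
  assumes T: "semidecidable (\<lambda>s. s 0 \<in> gn ` T)"
  shows "semidecidable (\<lambda>s. proof_axiom T (s 0))"
proof -
  \<comment> \<open>Quantifiers over formulas become quantifiers over codes. Where
    \<open>inst\<close> or \<open>ren\<close> occurs, its graph is inserted; fact \<open>3\<close>
    uses injectivity of \<open>gn\<close> to make both graphs speak of the same formula.\<close>
  have 1: "(\<exists>\<phi>. P (gn \<phi>)) \<longleftrightarrow> (\<exists>a. a \<in> range gn \<and> P a)" for P by blast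
  have 2: "(\<exists>\<phi>. P (gn \<phi>) (gn (F \<phi>))) \<longleftrightarrow>
    (\<exists>a b. (\<exists>\<phi>. a = gn \<phi> \<and> b = gn (F \<phi>)) \<and> P a b)" for P F by blast
  have 3: "(\<exists>\<phi>. P (gn (F \<phi>)) (gn (G \<phi>))) \<longleftrightarrow> (\<exists>a b c.
    (\<exists>\<phi>. a = gn \<phi> \<and> b = gn (F \<phi>)) \<and> (\<exists>\<phi>. a = gn \<phi> \<and> c = gn (G \<phi>)) \<and> P b c)" for P F G
    by auto
  have "proof_axiom T x \<longleftrightarrow> x \<in> gn ` T \<or>
    (\<exists>a. a \<in> range gn \<and> (\<exists>b. b \<in> range gn \<and>
      x = prod_encode (3, prod_encode (a, prod_encode (3, prod_encode (b, a)))))) \<or>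
    (\<exists>a. a \<in> range gn \<and> (\<exists>b. b \<in> range gn \<and> (\<exists>c. c \<in> range gn \<and>
      x = prod_encode (3, prod_encode (
        prod_encode (3, prod_encode (a, prod_encode (3, prod_encode (b, c)))),
        prod_encode (3, prod_encode (prod_encode (3, prod_encode (a, b)),
          prod_encode (3, prod_encode (a, c))))))))) \<or>
    (\<exists>a. a \<in> range gn \<and> (\<exists>b. b \<in> range gn \<and>
      x = prod_encode (3, prod_encode (
        prod_encode (3, prod_encode (prod_encode (2, a), prod_encode (2, b))),
        prod_encode (3, prod_encode (b, a)))))) \<or>
    (\<exists>m a b. (\<exists>\<phi>. a = gn \<phi> \<and> b = gn (inst \<phi> m)) \<and>
      x = prod_encode (3, prod_encode (prod_encode (4, a), b))) \<or>
    (\<exists>a. a \<in> range gn \<and> (\<exists>b. b \<in> range gn \<and>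
      x = prod_encode (3, prod_encode (
        prod_encode (4, prod_encode (3, prod_encode (a, b))),
        prod_encode (3, prod_encode (prod_encode (4, a), prod_encode (4, b))))))) \<or>
    (\<exists>a b. (\<exists>\<phi>. a = gn \<phi> \<and> b = gn (ren Suc \<phi>)) \<and>
      x = prod_encode (3, prod_encode (a, prod_encode (4, b)))) \<or>
    (\<exists>m. x = prod_encode (0, prod_encode (m, m))) \<or>
    (\<exists>m n a b c. (\<exists>\<phi>. a = gn \<phi> \<and> b = gn (inst \<phi> m)) \<and> (\<exists>\<phi>. a = gn \<phi> \<and> c = gn (inst \<phi> n)) \<and>
      x = prod_encode (3, prod_encode (prod_encode (0, prod_encode (m, n)),
        prod_encode (3, prod_encode (b, c)))))" for x
    unfolding proof_axiom_def gn.simps 1[symmetric] 2[symmetric] 3[symmetric] ..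
  then show ?thesis
    by (simp only:) (intro semidecidable_intros T semidecidable_formula semidecidable_inst
        semidecidable_ren_Suc computable_intros)
qed

lemma semidecidable_proves:
  assumes "semidecidable (\<lambda>s. s 0 \<in> gn ` T)" "computable f"
  shows "semidecidable (\<lambda>s. \<exists>\<phi>. f s = gn \<phi> \<and> T \<turnstile> \<phi>)"
proof (rule semidecidable_comp[OF _ assms(2)])
  show "semidecidable (\<lambda>s. \<exists>\<phi>. s 0 = gn \<phi> \<and> T \<turnstile> \<phi>)"
    unfolding generated_proof_iff[symmetric] 
    by (intro semidecidable_generated semidecidable_proof_axiom assms(1),
        unfold proof_rule_def, intro semidecidable_intros computable_intros)
qed

lemma RE_provable_set:
  assumes "semidecidable (\<lambda>s. s 0 \<in> gn ` T)" shows "RE (provable_set T)"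
proof (rule semidecidable_RE)
  have "x \<in> provable_set T \<longleftrightarrow> x \<in> gn ` Collect sentence \<and> (\<exists>\<phi>. x = gn \<phi> \<and> T \<turnstile> \<phi>)" for x
    by (auto simp: provable_set_def)
  then show "semidecidable (\<lambda>s. s 0 \<in> provable_set T)"
    by (simp only:) (intro semidecidable_conj semidecidable_sentence semidecidable_proves assms
        computable_var)
qed

lemma RE_refutable_set:
  assumes "semidecidable (\<lambda>s. s 0 \<in> gn ` T)" shows "RE (refutable_set T)"
proof (rule semidecidable_RE)
  have "(\<exists>\<psi>. prod_encode (2, gn \<phi>) = gn \<psi> \<and> T \<turnstile> \<psi>) \<longleftrightarrow> T \<turnstile> Neg \<phi>" for \<phi>
    using gn_eq_iff[of "Neg \<phi>"] by (simp del: gn_eq_iff)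
  then have "x \<in> refutable_set T \<longleftrightarrow>
      x \<in> gn ` Collect sentence \<and> (\<exists>\<phi>. prod_encode (2, x) = gn \<phi> \<and> T \<turnstile> \<phi>)" for x
    by (auto simp: refutable_set_def)
  then show "semidecidable (\<lambda>s. s 0 \<in> refutable_set T)"
    by (simp only:) (intro semidecidable_conj semidecidable_sentence semidecidable_proves assms
        computable_intros)
qed

lemma semidecidable_J_ext:
  assumes "RE B" "RE C" shows "semidecidable (\<lambda>s. s 0 \<in> gn ` J_ext B C)"
proof -
  have "x \<in> gn ` J_ext B C \<longleftrightarrow> x = gn E_refl \<or> x = gn E_sym \<or> x = gn E_trans \<or>
    (\<exists>n. x = gn (at_most_one_class n)) \<or> (\<exists>n. x = gn (many_large_classes n)) \<or>
    (\<exists>n. n \<in> B \<and> x = gn (A n)) \<or> (\<exists>n. n \<in> C \<and> x = gn (Neg (A n)))" for x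
    unfolding J_ext_def J_def by blast
  then show ?thesis
    by (simp only:) (intro semidecidable_intros RE_semidecidable assms computable_var computable_const
        computable_gn computable_gn_A computable_gn_many_large_classes computable_gn_at_most_one_class)
qed

section \<open>The model\<close>

fun sat :: "('a \<Rightarrow> 'a \<Rightarrow> bool) \<Rightarrow> (nat \<Rightarrow> 'a) \<Rightarrow> fm \<Rightarrow> bool" where
  "sat r s (Eq i j) \<longleftrightarrow> s i = s j"
| "sat r s (E i j) \<longleftrightarrow> r (s i) (s j)"
| "sat r s (Neg \<phi>) \<longleftrightarrow> \<not> sat r s \<phi>"
| "sat r s (Imp \<phi> \<psi>) \<longleftrightarrow> (sat r s \<phi> \<longrightarrow> sat r s \<psi>)"
| "sat r s (All \<phi>) \<longleftrightarrow> (\<forall>x. sat r (case_nat x s) \<phi>)"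

lemma sat_ren: "sat r s (ren f \<phi>) \<longleftrightarrow> sat r (\<lambda>k. s (f k)) \<phi>"
proof (induction \<phi> arbitrary: s f)
  case (All \<phi>)
  have "(\<lambda>k. case_nat x s (case k of 0 \<Rightarrow> 0 | Suc j \<Rightarrow> Suc (f j))) = case_nat x (\<lambda>k. s (f k))" for x
    by (auto split: nat.split)
  then show ?case by (simp add: All)
qed auto

lemma sat_inst: "sat r s (inst \<phi> m) \<longleftrightarrow> sat r (case_nat (s m) s) \<phi>"
proof -
  have "(\<lambda>k. s (case k of 0 \<Rightarrow> m | Suc j \<Rightarrow> j)) = case_nat (s m) s"
    by (auto split: nat.split)
  then show ?thesis by (simp add: inst_def sat_ren)
qed

lemma sat_cong: "(\<And>v. v \<in> fv \<phi> \<Longrightarrow> s v = s' v) \<Longrightarrow> sat r s \<phi> \<longleftrightarrow> sat r s' \<phi>"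
proof (induction \<phi> arbitrary: s s')
  case (Imp \<phi> \<psi>)
  have "sat r s \<phi> = sat r s' \<phi>" by (rule Imp.IH(1)) (simp add: Imp.prems)
  moreover have "sat r s \<psi> = sat r s' \<psi>" by (rule Imp.IH(2)) (simp add: Imp.prems)
  ultimately show ?case by simp
next
  case (Neg \<phi>)
  have "sat r s \<phi> = sat r s' \<phi>" by (rule Neg.IH) (simp add: Neg.prems)
  then show ?case by simp
next
  case (All \<phi>)
  have "sat r (case_nat x s) \<phi> = sat r (case_nat x s') \<phi>" for x
    by (rule All.IH) (auto intro: All.prems split: nat.split)
  then show ?case by simp
qed auto

lemma soundness:
  assumes "T \<turnstile> \<phi>" "\<And>\<psi> s. \<psi> \<in> T \<Longrightarrow> sat r s \<psi>"
  shows "sat r s \<phi>"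
  using assms(1)
proof (induction arbitrary: s)
  case (Axiom \<phi>)
  then show ?case by (rule assms(2))
qed (auto simp: sat_inst sat_ren)

lemma sat_conj_below: "sat r s (conj_below n f) \<longleftrightarrow> (\<forall>i<n. sat r s (f i))"
  by (induction n) (auto simp: less_Suc_eq)

lemma sat_Ex_pow:
  "sat r s ((Ex ^^ n) \<phi>) \<longleftrightarrow> (\<exists>f. sat r (\<lambda>k. if k < n then f k else s (k - n)) \<phi>)"
proof (induction n arbitrary: s)
  case (Suc n)
  let ?Q = "\<lambda>f. sat r (\<lambda>k. if k < Suc n then f k else s (k - Suc n)) \<phi>"
  \<comment> \<open>The outermost of the \<open>Suc n\<close> quantifiers binds variable
    \<open>n\<close>, so its value is the entry of \<open>f\<close> at \<open>n\<close>.\<close>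
  have *: "(\<lambda>k. if k < n then f k else case_nat x s (k - n)) =
      (\<lambda>k. if k < Suc n then (f(n := x)) k else s (k - Suc n))" for f x
  proof
    fix k
    consider "k < n" | "k = n" | m where "k = Suc (n + m)"
      by (metis less_iff_Suc_add linorder_neqE_nat)
    then show "(if k < n then f k else case_nat x s (k - n)) =
        (if k < Suc n then (f(n := x)) k else s (k - Suc n))"
      by cases auto
  qed
  have "sat r s ((Ex ^^ Suc n) \<phi>) \<longleftrightarrow>
      (\<exists>x f. sat r (\<lambda>k. if k < n then f k else case_nat x s (k - n)) \<phi>)"
    by (simp add: Suc)
  also have "\<dots> \<longleftrightarrow> (\<exists>x f. ?Q (f(n := x)))" by (simp only: *)
  also have "\<dots> \<longleftrightarrow> (\<exists>f. ?Q f)"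
  proof
    assume "\<exists>f. ?Q f"
    then obtain f where "?Q f" ..
    then have "?Q (f(n := f n))" by (simp only: fun_upd_triv)
    then show "\<exists>x f. ?Q (f(n := x))" by blast
  qed blast
  finally show ?case .
qed simp

text \<open>The left-hand side is what \<open>class_at_least\<close> expresses. Infinity is a
  separate disjunct because \<open>card\<close> is \<open>0\<close> on infinite sets.\<close>

lemma ex_card_subset_iff:
  "(\<exists>f. (\<forall>i<n. f i \<in> X) \<and> (\<forall>i<n. \<forall>j<i. f j \<noteq> f i)) \<longleftrightarrow> infinite X \<or> n \<le> card X"
proof
  assume "\<exists>f. (\<forall>i<n. f i \<in> X) \<and> (\<forall>i<n. \<forall>j<i. f j \<noteq> f i)"
  then obtain f where f: "\<forall>i<n. f i \<in> X" "\<forall>i<n. \<forall>j<i. f j \<noteq> f i" by blast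
  have "inj_on f {..<n}"
    by (rule linorder_inj_onI) (use f(2) in auto)
  then have "card (f ` {..<n}) = n" by (simp add: card_image)
  moreover have "f ` {..<n} \<subseteq> X" using f(1) by auto
  ultimately show "infinite X \<or> n \<le> card X" using card_mono by metis
next
  assume "infinite X \<or> n \<le> card X"
  then obtain Y where Y: "Y \<subseteq> X" "finite Y" "card Y = n"
    using infinite_arbitrarily_large obtain_subset_with_card_n by metis
  then obtain f where "bij_betw f {0..<n} Y" using ex_bij_betw_nat_finite by blast
  with Y(1) show "\<exists>f. (\<forall>i<n. f i \<in> X) \<and> (\<forall>i<n. \<forall>j<i. f j \<noteq> f i)"
    by (intro exI[of _ f]) (fastforce simp: bij_betw_def inj_on_def)
qed

lemma sat_class_at_least:
  "sat r s (class_at_least n x) \<longleftrightarrow> infinite {y. r y (s x)} \<or> n \<le> card {y. r y (s x)}"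
  unfolding ex_card_subset_iff[symmetric] class_at_least_def sat_Ex_pow
  by (rule ex_cong1) (auto simp: sat_conj_below)

lemma sat_class_exactly:
  "sat r s (class_exactly n x) \<longleftrightarrow> finite {y. r y (s x)} \<and> card {y. r y (s x)} = n"
  by (auto simp: class_exactly_def sat_class_at_least)

text \<open>The even numbers label infinite classes. For \<open>n \<in> B\<close>, the number \<open>2 * n + 1\<close> labels
  a class of size \<open>n + 1\<close>. All other pairs are put into class \<open>0\<close>, so that the model has
  no carrier set.\<close>

definition cls :: "nat set \<Rightarrow> nat \<times> nat \<Rightarrow> nat" where
  "cls B = (\<lambda>(k, i). if even k \<or> k div 2 \<in> B \<and> i \<le> k div 2 then k else 0)"

definition model :: "nat set \<Rightarrow> nat \<times> nat \<Rightarrow> nat \<times> nat \<Rightarrow> bool" where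
  "model B a b \<longleftrightarrow> cls B a = cls B b"

lemma infinite_even_class: "even k \<Longrightarrow> infinite {a. cls B a = k}"
proof -
  assume "even k"
  then have "Pair k ` UNIV \<subseteq> {a. cls B a = k}" by (auto simp: cls_def)
  moreover have "infinite (Pair k ` (UNIV :: nat set))" by (simp add: finite_image_iff inj_on_def)
  ultimately show ?thesis using finite_subset by blast
qed

lemma odd_class: "{a. cls B a = Suc (2 * n)} = (if n \<in> B then {Suc (2 * n)} \<times> {..n} else {})"
  by (auto simp: cls_def split: if_splits)

lemma cls_cases:
  obtains "even (cls B a)" | n where "n \<in> B" "cls B a = Suc (2 * n)"
proof (cases "even (cls B a)")
  case False
  then obtain n where n: "cls B a = Suc (2 * n)" by (metis oddE Suc_eq_plus1)
  then have "a \<in> {a. cls B a = Suc (2 * n)}" by simp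
  then have "n \<in> B" unfolding odd_class by (auto split: if_splits)
  with n that show thesis by blast
qed (rule that)

text \<open>Even labels belong to infinite classes, and the size of a finite class determines its
  label. Both the uniqueness axioms and the truth value of \<open>A n\<close> are read off from
  this.\<close>

lemma model_class_card:
  "finite {b. model B b a} \<and> card {b. model B b a} = n \<longleftrightarrow> (\<exists>m\<in>B. n = Suc m \<and> cls B a = Suc (2 * m))"
proof (cases B a rule: cls_cases)
  case 1
  with infinite_even_class[OF 1, of B] show ?thesis unfolding model_def by auto
next
  case (2 m)
  then show ?thesis unfolding model_def by (simp add: odd_class) auto
qed

lemma sat_A: "sat (model B) s (A n) \<longleftrightarrow> n \<in> B"
proof -
  have "sat (model B) s (A n) \<longleftrightarrow> (\<exists>a. n \<in> B \<and> cls B a = Suc (2 * n))"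
    by (auto simp: A_def sat_class_exactly model_class_card)
  moreover have "cls B (Suc (2 * n), 0) = Suc (2 * n)" if "n \<in> B" using that by (simp add: cls_def)
  ultimately show ?thesis by blast
qed

lemma sat_J:
  assumes "\<phi> \<in> J" shows "sat (model B) s \<phi>"
proof -
  from assms consider "\<phi> \<in> {E_refl, E_sym, E_trans}" | n where "\<phi> = at_most_one_class n"
    | n where "\<phi> = many_large_classes n" by (auto simp: J_def)
  then show ?thesis
  proof cases
    case 1
    then show ?thesis
      by (auto simp: E_refl_def E_sym_def E_trans_def model_def numeral_2_eq_2)
  next
    case 2
    then show ?thesis
      by (auto simp: at_most_one_class_def sat_class_exactly model_class_card)
        (auto simp: model_def)
  next
    case 3
    \<comment> \<open>The pairs \<open>(2 * i, 0)\<close> represent pairwise different infinite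
      classes.\<close>
    have "infinite {b. model B b (2 * i, 0)}" for i
      using infinite_even_class[of "2 * i" B] by (simp add: model_def cls_def)
    then show ?thesis unfolding 3 many_large_classes_def sat_Ex_pow
      by (intro exI[of _ "\<lambda>i. (2 * i, 0)"])
        (auto simp: sat_conj_below sat_class_at_least model_def cls_def)
  qed
qed

lemma sat_J_ext:
  assumes "B \<inter> C = {}" "J_ext B C \<turnstile> \<phi>" shows "sat (model B) s \<phi>"
  using assms(2)
proof (rule soundness)
  fix \<psi> s assume "\<psi> \<in> J_ext B C"
  then show "sat (model B) s \<psi>"
    using assms(1) unfolding J_ext_def by (auto simp: sat_J sat_A)
qed

section \<open>Indistinguishability of elements of large classes\<close>

fun depth :: "fm \<Rightarrow> nat" where
  "depth (Eq i j) = 0"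
| "depth (E i j) = 0"
| "depth (Neg \<phi>) = depth \<phi>"
| "depth (Imp \<phi> \<psi>) = max (depth \<phi>) (depth \<psi>)"
| "depth (All \<phi>) = Suc (depth \<phi>)"

definition large :: "('a \<Rightarrow> 'a \<Rightarrow> bool) \<Rightarrow> nat \<Rightarrow> 'a \<Rightarrow> bool" where
  "large r K a \<longleftrightarrow> infinite {b. r a b} \<or> K \<le> card {b. r a b}"

text \<open>A matched pair may change its class only if both classes have at least \<open>K\<close>
  elements. Such classes cannot be exhausted by fewer than \<open>K\<close> pairs, while a smaller
  class is matched with itself.\<close>

definition partial_iso :: "('a \<Rightarrow> 'a \<Rightarrow> bool) \<Rightarrow> nat \<Rightarrow> ('a \<times> 'a) set \<Rightarrow> bool" where
  "partial_iso r K P \<longleftrightarrow> finite P \<and> (\<forall>a b. (a, b) \<in> P \<longrightarrow>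
    (r a b \<or> large r K a \<and> large r K b) \<and>
    (\<forall>c d. (c, d) \<in> P \<longrightarrow> (a = c \<longleftrightarrow> b = d) \<and> (r a c \<longleftrightarrow> r b d)))"

text \<open>\<open>new_class\<close> supplies the answer to a move that opens a new large
  class.\<close>

locale many_infinite_classes =
  fixes r :: "'a \<Rightarrow> 'a \<Rightarrow> bool"
  assumes equivp: "equivp r"
    and new_class: "\<And>S. finite S \<Longrightarrow> \<exists>d. infinite {b. r d b} \<and> (\<forall>a\<in>S. \<not> r d a)"
begin

lemma rel_refl: "r a a" and rel_sym: "r a b \<Longrightarrow> r b a" and rel_trans: "r a b \<Longrightarrow> r b c \<Longrightarrow> r a c"
  using equivp by (blast intro: equivp_reflp equivp_symp equivp_transp)+

lemma class_eq: "r a b \<Longrightarrow> {c. r a c} = {c. r b c}"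
  using rel_sym rel_trans by blast

lemma rel_cong: "r a b \<Longrightarrow> r a c \<longleftrightarrow> r b c"
  using rel_sym rel_trans by blast

lemma large_cong: "r a b \<Longrightarrow> large r K a \<longleftrightarrow> large r K b"
  by (simp add: large_def class_eq)

lemma partial_iso_converse: "partial_iso r K P \<Longrightarrow> partial_iso r K (P\<inverse>)"
  unfolding partial_iso_def using rel_sym by auto

lemma partial_iso_insert:
  assumes P: "partial_iso r K P" and d: "r d d' \<or> large r K d \<and> large r K d'"
    and eq: "\<And>a b. (a, b) \<in> P \<Longrightarrow> d = a \<longleftrightarrow> d' = b"
    and rel: "\<And>a b. (a, b) \<in> P \<Longrightarrow> r d a \<longleftrightarrow> r d' b"
  shows "partial_iso r K (insert (d, d') P)"
proof -
  have "r a d \<longleftrightarrow> r b d'" if "(a, b) \<in> P" for a b using rel[OF that] rel_sym by blast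
  with P d eq rel rel_refl show ?thesis unfolding partial_iso_def by auto
qed

text \<open>This is one forth move of the game. The cases are that \<open>d\<close> is already
  matched, that its class is met by the domain, and that its class is new.\<close>

lemma partial_iso_extend:
  assumes P: "partial_iso r K P" and card: "card P < K"
  shows "\<exists>d'. partial_iso r K (insert (d, d') P)"
proof -
  have fin: "finite P" and PD: "\<And>a b. (a, b) \<in> P \<Longrightarrow> r a b \<or> large r K a \<and> large r K b"
    and Peq: "\<And>a b c e. (a, b) \<in> P \<Longrightarrow> (c, e) \<in> P \<Longrightarrow> a = c \<longleftrightarrow> b = e"
    and Prel: "\<And>a b c e. (a, b) \<in> P \<Longrightarrow> (c, e) \<in> P \<Longrightarrow> r a c \<longleftrightarrow> r b e"
    using P unfolding partial_iso_def by blast+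
  consider b where "(d, b) \<in> P" | a b where "(a, b) \<in> P" "r a d" "d \<notin> Domain P"
    | "\<And>a b. (a, b) \<in> P \<Longrightarrow> \<not> r a d" by blast
  then show ?thesis
  proof cases
    case 1
    with P show ?thesis by (metis insert_absorb)
  next
    case 2
    \<comment> \<open>The class of \<open>b\<close> must contain an unmatched element. If it is
      large, compare \<open>P\<close> with \<open>K\<close>. If it is small, it is also the class of
      \<open>a\<close>: equally many of its elements are matched on both sides, and \<open>d\<close>
      is unmatched in the domain.\<close>
    have "\<exists>d'. r b d' \<and> d' \<notin> Range P"
    proof (cases "infinite {c. r b c}")
      case True
      then have "\<not> {c. r b c} \<subseteq> Range P" using fin finite_subset finite_Range by blast
      then show ?thesis by blast
    next
      case False
      have "card ({c. r b c} \<inter> Range P) < card {c. r b c}"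
      proof (cases "large r K b")
        case True
        have "card ({c. r b c} \<inter> Range P) \<le> card (snd ` P)"
          using fin by (intro card_mono) (auto simp: Range_snd)
        also have "\<dots> \<le> card P" using fin by (rule card_image_le)
        also have "\<dots> < card {c. r b c}" using True \<open>\<not> infinite _\<close> card by (simp add: large_def)
        finally show ?thesis .
      next
        case False
        with PD[OF 2(1)] have "r a b" by blast
        define Q where "Q = {p \<in> P. r a (fst p)}"
        have "{c. r b c} \<inter> Range P = snd ` Q" "{c. r a c} \<inter> Domain P = fst ` Q"
          unfolding Q_def using Prel[OF 2(1)] by force+
        moreover have "card (snd ` Q) = card Q" "card (fst ` Q) = card Q"
          by (rule card_image; use Peq in \<open>force simp: inj_on_def Q_def\<close>)+
        ultimately have "card ({c. r b c} \<inter> Range P) = card ({c. r a c} \<inter> Domain P)" by simp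
        also have "\<dots> < card {c. r a c}"
          using 2 \<open>\<not> infinite _\<close> class_eq[OF \<open>r a b\<close>] by (intro psubset_card_mono) auto
        finally show ?thesis by (simp add: class_eq[OF \<open>r a b\<close>])
      qed
      then have "{c. r b c} \<inter> Range P \<noteq> {c. r b c}" by force
      then show ?thesis by blast
    qed
    then obtain d' where d': "r b d'" "d' \<notin> Range P" by blast
    have "partial_iso r K (insert (d, d') P)"
    proof (rule partial_iso_insert[OF P])
      show "r d d' \<or> large r K d \<and> large r K d'"
        using PD[OF 2(1)] rel_trans[OF rel_trans[OF rel_sym[OF 2(2)]] d'(1)]
          large_cong[OF 2(2)] large_cong[OF d'(1)] by blast
      show "d = c \<longleftrightarrow> d' = e" if "(c, e) \<in> P" for c e using that 2(3) d'(2) by blast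
      show "r d c \<longleftrightarrow> r d' e" if "(c, e) \<in> P" for c e
        using Prel[OF 2(1) that] rel_cong[OF 2(2)] rel_cong[OF d'(1)] by blast
    qed
    then show ?thesis by blast
  next
    case 3
    then have 3: "\<not> r d a" "d \<noteq> a" if "(a, b) \<in> P" for a b
      using that rel_sym rel_refl by blast+
    show ?thesis
    proof (cases "large r K d")
      case True
      obtain d' where d': "infinite {b. r d' b}" "\<forall>a\<in>Range P. \<not> r d' a"
        using new_class[of "Range P"] fin finite_Range by blast
      then have "\<not> r d' b" "d' \<noteq> b" if "(a, b) \<in> P" for a b
        using that rel_refl by blast+
      with True d'(1) 3 have "partial_iso r K (insert (d, d') P)"
        by (intro partial_iso_insert[OF P]) (auto simp: large_def)
      then show ?thesis by blast
    next
      case False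
      \<comment> \<open>A small class can only be matched with itself, so if the domain does not
        meet it, neither does the range; \<open>d\<close> is then its own answer.\<close>
      have "\<not> r d b" if "(a, b) \<in> P" for a b
      proof
        assume "r d b"
        with False have "\<not> large r K b" using large_cong by blast
        with PD[OF that] have "r a b" by blast
        with \<open>r d b\<close> 3(1)[OF that] rel_sym rel_trans show False by blast
      qed
      moreover from this have "d \<noteq> b" if "(a, b) \<in> P" for a b
        using that rel_refl by blast
      ultimately have "partial_iso r K (insert (d, d) P)"
        using 3 rel_refl by (intro partial_iso_insert[OF P]) blast+
      then show ?thesis by blast
    qed
  qed
qed

text \<open>\<open>K\<close> is a budget shared by the pairs already matched and the quantifiers
  still to come. A back move is a forth move of the converse.\<close>

lemma sat_partial_iso:
  assumes "partial_iso r K P" "card P + depth \<phi> \<le> K" "\<And>v. v \<in> fv \<phi> \<Longrightarrow> (s v, s' v) \<in> P"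
  shows "sat r s \<phi> \<longleftrightarrow> sat r s' \<phi>"
  using assms
proof (induction \<phi> arbitrary: P s s')
  case (Eq i j)
  then show ?case unfolding partial_iso_def by simp
next
  case (E i j)
  then show ?case unfolding partial_iso_def by simp
next
  case (Neg \<phi>)
  have "sat r s \<phi> = sat r s' \<phi>" by (rule Neg.IH[of P]) (use Neg.prems in auto)
  then show ?case by simp
next
  case (Imp \<phi> \<psi>)
  have "sat r s \<phi> = sat r s' \<phi>" by (rule Imp.IH(1)[of P]) (use Imp.prems in auto)
  moreover have "sat r s \<psi> = sat r s' \<psi>" by (rule Imp.IH(2)[of P]) (use Imp.prems in auto)
  ultimately show ?case by simp
next
  case (All \<phi>)
  have *: "sat r (case_nat d s) \<phi> \<longleftrightarrow> sat r (case_nat d' s') \<phi>"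
    if "partial_iso r K (insert (d, d') P)" for d d'
  proof (rule All.IH[OF that])
    have "card (insert (d, d') P) \<le> Suc (card P)" by (rule card_insert_le_m1) auto
    with All.prems(2) show "card (insert (d, d') P) + depth \<phi> \<le> K" by simp
    show "(case_nat d s v, case_nat d' s' v) \<in> insert (d, d') P" if "v \<in> fv \<phi>" for v
      using that All.prems(3) by (cases v) auto
  qed
  have card: "card P < K" "card (P\<inverse>) < K" using All.prems(2) by auto
  have "\<exists>d'. partial_iso r K (insert (d, d') P)" for d
    by (rule partial_iso_extend[OF All.prems(1) card(1)])
  moreover have "\<exists>d. partial_iso r K (insert (d, d') P)" for d'
  proof -
    from partial_iso_extend[OF partial_iso_converse[OF All.prems(1)] card(2)]
    obtain d where "partial_iso r K (insert (d', d) (P\<inverse>))" by blast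
    then have "partial_iso r K ((insert (d', d) (P\<inverse>))\<inverse>)" by (rule partial_iso_converse)
    also have "(insert (d', d) (P\<inverse>))\<inverse> = insert (d, d') P" by auto
    finally show ?thesis ..
  qed
  ultimately show ?case using * by (metis sat.simps(5))
qed

text \<open>The transposition of \<open>a\<close> and \<open>b\<close> is a partial isomorphism, as
  \<open>r\<close> is symmetric and both elements are large. It has at most two pairs, whence the
  summand 2.\<close>

lemma sat_swap:
  assumes "fv \<phi> \<subseteq> {..<2}" "large r (depth \<phi> + 2) a" "large r (depth \<phi> + 2) b"
  shows "sat r (case_nat a (\<lambda>_. b)) \<phi> \<longleftrightarrow> sat r (case_nat b (\<lambda>_. a)) \<phi>"
proof (rule sat_partial_iso)
  show "partial_iso r (depth \<phi> + 2) {(a, b), (b, a)}"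
    unfolding partial_iso_def using assms(2,3) rel_refl rel_sym by auto
  show "card {(a, b), (b, a)} + depth \<phi> \<le> depth \<phi> + 2" by (cases "a = b") simp_all
  show "(case_nat a (\<lambda>_. b) v, case_nat b (\<lambda>_. a) v) \<in> {(a, b), (b, a)}" if "v \<in> fv \<phi>" for v
    using that assms(1) by (cases v) auto
qed

end

lemma many_infinite_classes_model: "many_infinite_classes (model B)"
proof
  show "equivp (model B)"
    by (intro equivpI reflpI sympI transpI) (simp_all add: model_def)
  show "\<exists>d. infinite {b. model B d b} \<and> (\<forall>a\<in>S. \<not> model B d a)" if "finite S" for S
  proof (intro exI conjI ballI)
    \<comment> \<open>An even label larger than every label that occurs in \<open>S\<close>.\<close>
    let ?k = "2 * Suc (sum (cls B) S)"
    have d: "cls B (?k, 0) = ?k" by (simp add: cls_def)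
    show "infinite {b. model B (?k, 0) b}"
      using infinite_even_class[of ?k B] unfolding model_def d by (simp add: eq_commute)
    show "\<not> model B (?k, 0) a" if "a \<in> S" for a
      using member_le_sum[of a S "cls B"] that \<open>finite S\<close> unfolding model_def d by simp
  qed
qed

text \<open>Only finite classes can fail to be large, and there is at most one of each size, so
  those below the threshold have finitely many elements altogether.\<close>

lemma finite_not_large: "finite {a. \<not> large (model B) K a}"
proof (rule finite_subset)
  show "{a. \<not> large (model B) K a} \<subseteq> (\<Union>n<K. {Suc (2 * n)} \<times> {..n})"
  proof
    fix a assume "a \<in> {a. \<not> large (model B) K a}"
    then have a: "finite {b. cls B b = cls B a}" "card {b. cls B b = cls B a} < K"
      by (auto simp: large_def model_def eq_commute[of "cls B a"])
    show "a \<in> (\<Union>n<K. {Suc (2 * n)} \<times> {..n})"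
    proof (cases B a rule: cls_cases)
      case 1
      with a(1) infinite_even_class show ?thesis by blast
    next
      case (2 n)
      have "a \<in> {b. cls B b = Suc (2 * n)}" using 2 by simp
      with 2 a(2) show ?thesis unfolding 2(2) odd_class by auto
    qed
  qed
qed auto

section \<open>Interpretations of R\<close>

text \<open>Variables beyond the arity receive a default value, a copy of the last argument.\<close>

definition rel1 :: "('a \<Rightarrow> 'a \<Rightarrow> bool) \<Rightarrow> fm \<Rightarrow> 'a \<Rightarrow> bool" where
  "rel1 r \<phi> a \<longleftrightarrow> sat r (\<lambda>_. a) \<phi>"

definition rel2 :: "('a \<Rightarrow> 'a \<Rightarrow> bool) \<Rightarrow> fm \<Rightarrow> 'a \<Rightarrow> 'a \<Rightarrow> bool" where
  "rel2 r \<phi> a b \<longleftrightarrow> sat r (case_nat a (\<lambda>_. b)) \<phi>"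

lemma sat_rel1: "fv \<phi> \<subseteq> {..<1} \<Longrightarrow> sat r s \<phi> \<longleftrightarrow> rel1 r \<phi> (s 0)"
  unfolding rel1_def by (rule sat_cong) auto

lemma sat_app1: "fv \<phi> \<subseteq> {..<1} \<Longrightarrow> sat r s (app \<phi> [i]) \<longleftrightarrow> rel1 r \<phi> (s i)"
  by (simp add: app_def sat_ren sat_rel1)

lemma sat_app2: "fv \<phi> \<subseteq> {..<2} \<Longrightarrow> sat r s (app \<phi> [i, j]) \<longleftrightarrow> rel2 r \<phi> (s i) (s j)"
  unfolding rel2_def app_def sat_ren
proof (rule sat_cong)
  fix v assume "fv \<phi> \<subseteq> {..<2}" "v \<in> fv \<phi>"
  then have "v < 2" by auto
  then have "v = 0 \<or> v = 1" by auto
  then show "s ([i, j] ! v) = case_nat (s i) (\<lambda>_. s j) v" by auto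
qed

locale interpretation_in =
  fixes r :: "'a \<Rightarrow> 'a \<Rightarrow> bool" and I :: transl
  assumes tr: "translation I"
    and equality: "\<And>\<phi> s. \<phi> \<in> equality_axioms I \<Longrightarrow> sat r s \<phi>"
    and axioms: "\<And>\<phi> s. \<phi> \<in> R \<Longrightarrow> sat r s (translate I \<phi>)"
begin

abbreviation "D \<equiv> rel1 r (domI I)"
abbreviation "Q \<equiv> rel2 r (eqI I)"
abbreviation "L \<equiv> rel2 r (leI I)"
abbreviation "Z \<equiv> rel1 r (zeroI I)"
abbreviation "Sc \<equiv> rel2 r (sucI I)"

lemma fv_transl: "fv (domI I) \<subseteq> {..<1}" "fv (eqI I) \<subseteq> {..<2}" "fv (leI I) \<subseteq> {..<2}"
  "fv (zeroI I) \<subseteq> {..<1}" "fv (sucI I) \<subseteq> {..<2}"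
  using tr unfolding translation_def by blast+

lemma sat_AllI: "sat r s (AllI I \<phi>) \<longleftrightarrow> (\<forall>x. D x \<longrightarrow> sat r (case_nat x s) \<phi>)"
  by (simp add: AllI_def sat_rel1[OF fv_transl(1)])

lemma sat_ExI: "sat r s (ExI I \<phi>) \<longleftrightarrow> (\<exists>x. D x \<and> sat r (case_nat x s) \<phi>)"
  by (simp add: ExI_def sat_rel1[OF fv_transl(1)])

lemmas sat_apps = sat_app2[OF fv_transl(2)] sat_app2[OF fv_transl(3)] sat_app1[OF fv_transl(4)] sat_app2[OF fv_transl(5)]

text \<open>One statement serves equality, order and the graph of successor. For equality, together
  with reflexivity, it yields symmetry and transitivity.\<close>

lemma sat_congruent:
  assumes "fv \<phi> \<subseteq> {..<2}" "sat r s (congruent I 2 \<phi>)" "D a" "D b" "D c" "D d"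
    "Q a c" "Q b d" "rel2 r \<phi> a b"
  shows "rel2 r \<phi> c d"
proof -
  have "sat r s (AllI I (AllI I (AllI I (AllI I (Imp
      (And (conj_below 2 (\<lambda>i. app (eqI I) [i, 2 + i])) (app \<phi> [0, 1])) (app \<phi> [2, 3]))))))"
    using assms(2) by (simp add: congruent_def numeral_eq_Suc upt_rec)
  then show ?thesis using assms
    by (simp add: sat_AllI sat_conj_below sat_apps sat_app2[OF assms(1)] numeral_eq_Suc
        less_Suc_eq all_conj_distrib imp_conjL)
qed

lemma Q_refl: "D a \<Longrightarrow> Q a a"
  using equality[of "AllI I (app (eqI I) [0, 0])"]
  by (simp add: equality_axioms_def sat_AllI sat_apps)

lemma Q_cong: "D a \<Longrightarrow> D b \<Longrightarrow> D c \<Longrightarrow> D d \<Longrightarrow> Q a c \<Longrightarrow> Q b d \<Longrightarrow> Q a b \<Longrightarrow> Q c d"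
  by (rule sat_congruent[OF fv_transl(2) equality, where a = a and b = b]) (simp_all add: equality_axioms_def)

lemma L_cong: "D a \<Longrightarrow> D b \<Longrightarrow> D c \<Longrightarrow> D d \<Longrightarrow> Q a c \<Longrightarrow> Q b d \<Longrightarrow> L a b \<Longrightarrow> L c d"
  by (rule sat_congruent[OF fv_transl(3) equality, where a = a and b = b]) (simp_all add: equality_axioms_def)

lemma Sc_cong: "D a \<Longrightarrow> D b \<Longrightarrow> D c \<Longrightarrow> D d \<Longrightarrow> Q a c \<Longrightarrow> Q b d \<Longrightarrow> Sc a b \<Longrightarrow> Sc c d"
  by (rule sat_congruent[OF fv_transl(5) equality, where a = a and b = b]) (simp_all add: equality_axioms_def numeral_2_eq_2)

lemma Q_sym: "D a \<Longrightarrow> D b \<Longrightarrow> Q a b \<Longrightarrow> Q b a"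
  by (rule Q_cong[of a a]) (auto intro: Q_refl)

lemma Q_trans: "D a \<Longrightarrow> D b \<Longrightarrow> D c \<Longrightarrow> Q a b \<Longrightarrow> Q b c \<Longrightarrow> Q a c"
  by (rule Q_cong[of a b]) (auto intro: Q_refl)

lemma Z_ex: "\<exists>a. D a \<and> Z a"
  using equality[of "total I 0 (zeroI I)"]
  by (simp add: equality_axioms_def total_def sat_ExI sat_apps)

lemma Z_unique: "D a \<Longrightarrow> D b \<Longrightarrow> Z a \<Longrightarrow> Z b \<Longrightarrow> Q a b"
  using equality[of "single_valued I 0 (zeroI I)"]
  by (simp add: equality_axioms_def single_valued_def sat_AllI sat_apps numeral_2_eq_2)

lemma Sc_ex: "D a \<Longrightarrow> \<exists>b. D b \<and> Sc a b"
  using equality[of "total I 1 (sucI I)"]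
  by (simp add: equality_axioms_def total_def sat_AllI sat_ExI sat_apps)

lemma Sc_unique: "D a \<Longrightarrow> D b \<Longrightarrow> D c \<Longrightarrow> Sc a b \<Longrightarrow> Sc a c \<Longrightarrow> Q b c"
  using equality[of "single_valued I 1 (sucI I)"]
  by (simp add: equality_axioms_def single_valued_def sat_AllI sat_apps numeral_eq_Suc upt_rec)

text \<open>The values of a numeral form a relation, because zero and successor are single-valued
  only up to \<open>Q\<close>.\<close>

primrec N :: "nat \<Rightarrow> 'a \<Rightarrow> bool" where
  "N 0 a \<longleftrightarrow> Z a"
| "N (Suc n) a \<longleftrightarrow> (\<exists>b. D b \<and> N n b \<and> Sc b a)"

lemma N_ex: "\<exists>a. D a \<and> N n a"
proof (induction n)
  case (Suc n)
  then obtain a where "D a" "N n a" by blast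
  with Sc_ex[of a] show ?case by auto
qed (simp add: Z_ex)

lemma N_unique: "D a \<Longrightarrow> D b \<Longrightarrow> N n a \<Longrightarrow> N n b \<Longrightarrow> Q a b"
proof (induction n arbitrary: a b)
  case 0
  then show ?case by (simp add: Z_unique)
next
  case (Suc n)
  then obtain c d where c: "D c" "N n c" "Sc c a" and d: "D d" "N n d" "Sc d b" by auto
  have "Sc d a"
    by (rule Sc_cong[of c a]) (use c d Suc Q_refl in auto)
  with Sc_unique[of d a b] d Suc.prems show ?case by simp
qed

lemma sat_graph_num: "sat r s (graph I k (num n) y) \<longleftrightarrow> N n (s y)"
  by (induction n arbitrary: k s y) (auto simp: num_def sat_apps sat_ExI)

lemma sat_graph_var: "sat r s (graph I k (AVar i) y) \<longleftrightarrow> Q (s (i + k)) (s y)"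
  by (simp add: sat_apps)

lemmas sat_atoms = sat_ExI sat_AllI sat_graph_num sat_graph_var sat_apps

lemma N_neq: "m \<noteq> n \<Longrightarrow> D a \<Longrightarrow> D b \<Longrightarrow> N m a \<Longrightarrow> N n b \<Longrightarrow> \<not> Q a b"
  using axioms[OF R.neq, of m n] by (simp add: sat_atoms numeral_2_eq_2 del: graph.simps)

text \<open>The values \<open>u\<close> and \<open>v\<close> come from unnesting the equation;
  transitivity of \<open>Q\<close> removes them later.\<close>

lemma sat_one_of_upto:
  "sat r s (translate I (one_of_upto (AVar 0) n)) \<longleftrightarrow>
    (\<exists>i\<le>n. \<exists>u v. D u \<and> D v \<and> Q (s 0) u \<and> N i v \<and> Q u v)"
proof (induction n)
  case (Suc n)
  have "(\<exists>i\<le>Suc n. P i) \<longleftrightarrow> (\<exists>i\<le>n. P i) \<or> P (Suc n)" for P by (auto simp: le_Suc_eq)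
  with Suc show ?case
    by (simp add: sat_atoms numeral_2_eq_2 del: graph.simps N.simps) blast
qed (auto simp: sat_atoms numeral_2_eq_2 simp del: graph.simps N.simps)

lemma L_numeral:
  assumes "D x" "D u" "D v" "Q x u" "N n v" "L u v"
  shows "\<exists>i\<le>n. \<exists>u v. D u \<and> D v \<and> Q x u \<and> N i v \<and> Q u v"
  using axioms[OF R.le, of _ n] assms
  by (simp add: sat_atoms sat_one_of_upto numeral_2_eq_2 del: graph.simps one_of_upto.simps) blast

lemma L_linear:
  assumes "D x"
  shows "(\<exists>u v. D u \<and> D v \<and> Q x u \<and> N n v \<and> L u v) \<or>
    (\<exists>u v. D u \<and> D v \<and> N n u \<and> Q x v \<and> L u v)"
  using axioms[OF R.linear, of _ n] assms
  by (simp add: sat_atoms numeral_2_eq_2 del: graph.simps) blast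

text \<open>If \<open>b\<close> were below \<open>a\<close>, then \<open>R.le\<close> would identify
  \<open>b\<close> with a value of a numeral up to \<open>m\<close>, against \<open>R.neq\<close>.
  Linearity then leaves only the other order.\<close>

lemma L_numerals:
  assumes "m < n" "D a" "D b" "N m a" "N n b"
  shows "L a b" "\<not> L b a"
proof -
  have no: False if uv: "D u" "D v" "Q b u" "N m v" "L u v" for u v
  proof -
    from L_numeral[OF assms(3) uv] obtain i u v
      where "i \<le> m" "D u" "D v" "Q b u" "N i v" "Q u v" by blast
    moreover from this have "Q b v" using Q_trans assms(3) by blast
    ultimately show False using N_neq[of n i b v] assms by simp
  qed
  show "\<not> L b a" using no[of b a] assms Q_refl by blast
  from L_linear[OF assms(3), of m] no obtain u v
    where uv: "D u" "D v" "N m u" "Q b v" "L u v" by blast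
  show "L a b"
    by (rule L_cong[of u v]) (use uv assms N_unique Q_sym in auto)
qed

end

lemma J_ext_not_interprets:
  assumes "B \<inter> C = {}" shows "\<not> interprets (J_ext B C) R"
proof
  assume "interprets (J_ext B C) R"
  then obtain I where "translation I" "\<forall>\<phi>\<in>equality_axioms I. J_ext B C \<turnstile> \<phi>"
    "\<forall>\<phi>\<in>R. J_ext B C \<turnstile> translate I \<phi>" unfolding interprets_def by blast
  then interpret interpretation_in "model B" I
    by unfold_locales (auto intro: sat_J_ext[OF assms])
  interpret many_infinite_classes "model B" by (rule many_infinite_classes_model)
  obtain a where a: "\<And>n. D (a n)" "\<And>n. N n (a n)" using N_ex by metis
  \<comment> \<open>Values of different numerals are not even \<open>Q\<close>-related, hence they
    are distinct.\<close>
  have "inj a"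
  proof (rule injI)
    fix m n assume "a m = a n"
    with N_neq[of m n "a m" "a n"] a Q_refl show "m = n" by metis
  qed
  \<comment> \<open>The threshold that \<open>sat_swap\<close> demands for the formula interpreting
    \<open>\<le>\<close>.\<close>
  let ?K = "depth (leI I) + 2"
  have "finite (a -` {x. \<not> large (model B) ?K x})"
    using finite_not_large \<open>inj a\<close> by (rule finite_vimageI)
  then obtain k where k: "\<And>n. n \<in> a -` {x. \<not> large (model B) ?K x} \<Longrightarrow> n < k"
    unfolding finite_nat_set_iff_bounded by blast
  then have "large (model B) ?K (a k)" "large (model B) ?K (a (Suc k))" by force+
  from sat_swap[OF fv_transl(3) this] have "L (a k) (a (Suc k)) \<longleftrightarrow> L (a (Suc k)) (a k)"
    by (simp add: rel2_def)
  with L_numerals[of k "Suc k" "a k" "a (Suc k)"] a show False by simp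
qed

section \<open>Separation and effective inseparability\<close>

lemma J_ext_disjoint:
  assumes "B \<inter> C = {}" shows "provable_set (J_ext B C) \<inter> refutable_set (J_ext B C) = {}"
proof -
  have False if "J_ext B C \<turnstile> \<phi>" "J_ext B C \<turnstile> Neg \<phi>" for \<phi>
    using sat_J_ext[OF assms that(1)] sat_J_ext[OF assms that(2)] by simp
  then show ?thesis by (auto simp: provable_set_def refutable_set_def)
qed

lemma disjoint_RE_pair_J_ext:
  assumes "disjoint_RE_pair B C"
  shows "disjoint_RE_pair (provable_set (J_ext B C)) (refutable_set (J_ext B C))"
  using assms unfolding disjoint_RE_pair_def
  by (auto intro!: RE_provable_set RE_refutable_set semidecidable_J_ext simp: J_ext_disjoint)

lemma fv_Ex_pow: "fv \<phi> \<subseteq> {..<n + m} \<Longrightarrow> fv ((Ex ^^ n) \<phi>) \<subseteq> {..<m}"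
proof (induction n arbitrary: m)
  case (Suc n)
  then have "fv ((Ex ^^ n) \<phi>) \<subseteq> {..<Suc m}" by simp
  then show ?case by auto
qed simp

lemma fv_conj_below: "fv (conj_below n f) = (\<Union>i<n. fv (f i))"
  by (induction n) (auto simp: less_Suc_eq)

lemma sentence_A: "sentence (A n)"
proof -
  have "fv (class_at_least k 0) \<subseteq> {..<1}" for k
    unfolding class_at_least_def by (rule fv_Ex_pow) (auto simp: fv_conj_below)
  then have "fv (class_exactly k 0) \<subseteq> {..<1}" for k unfolding class_exactly_def by simp
  then show ?thesis unfolding A_def sentence_def by auto
qed

lemma A_provable: "n \<in> B \<Longrightarrow> gn (A n) \<in> provable_set (J_ext B C)"
  and A_refutable: "n \<in> C \<Longrightarrow> gn (A n) \<in> refutable_set (J_ext B C)"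
  unfolding provable_set_def refutable_set_def using sentence_A
  by (auto intro!: exI[of _ "A n"] proves.Axiom simp: J_ext_def)

lemma RI_J_ext:
  assumes "RI B C" shows "RI_theory (J_ext B C)"
  unfolding RI_theory_def RI_def
proof (intro conjI notI)
  show "disjoint_RE_pair (provable_set (J_ext B C)) (refutable_set (J_ext B C))"
    using assms disjoint_RE_pair_J_ext by (simp add: RI_def)
  assume "\<exists>Z. recursive_set Z \<and> provable_set (J_ext B C) \<subseteq> Z \<and> Z \<inter> refutable_set (J_ext B C) = {}"
  then obtain Z where Z: "recursive_set Z" "provable_set (J_ext B C) \<subseteq> Z"
    "Z \<inter> refutable_set (J_ext B C) = {}" by blast
  let ?Z = "{n. gn (A n) \<in> Z}"
  have "recursive_set ?Z"
    using decidable_subst[OF Z(1)[unfolded recursive_set_iff], of "\<lambda>_ s. gn (A (s 0))"]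
      computable_gn_A by (simp add: recursive_set_iff)
  moreover have "B \<subseteq> ?Z" "?Z \<inter> C = {}" using Z(2,3) A_provable A_refutable by blast+
  ultimately show False using assms unfolding RI_def by blast
qed

lemma EI_J_ext:
  assumes "EI B C" shows "EI_theory (J_ext B C)"
proof -
  from assms obtain f where f: "recursive_fun2 f" and
    ei: "\<And>i j. B \<subseteq> W i \<Longrightarrow> C \<subseteq> W j \<Longrightarrow> W i \<inter> W j = {} \<Longrightarrow> f i j \<notin> W i \<union> W j"
    unfolding EI_def by blast
  from computable_unary[OF computable_gn_A] obtain eA where eA: "\<And>n. eval eA [n] (gn (A n))"
    by blast
  \<comment> \<open>\<open>h i\<close> is the code of \<open>Comp e [eA]\<close> if \<open>i\<close>
    is the code of \<open>e\<close>, and no code otherwise. As plain arithmetic on \<open>i\<close>,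
    it is computable.\<close>
  define h where "h i = prod_encode (3, prod_encode (i, list_encode [code eA]))" for i
  have W_h: "W (h i) = {n. gn (A n) \<in> W i}" for i
  proof -
    have "n \<in> W (h i) \<longleftrightarrow> gn (A n) \<in> W i" for n
    proof
      assume "n \<in> W (h i)"
      then obtain e y where e: "code e = h i" "eval e [n] y" unfolding W_def by blast
      then obtain e' gs where e': "e = Comp e' gs" "code e' = i" "list_encode (map code gs) = list_encode [code eA]"
        by (cases e) (auto simp: h_def simp del: list_encode.simps)
      from e'(3) have "map code gs = [code eA]" by (simp only: list_encode_eq)
      then have "gs = [eA]" by (auto dest: code_inj)
      with e(2) e'(1) obtain z where "eval eA [n] z" "eval e' [z] y"
        by (auto elim!: eval_CompE simp: length_Suc_conv)
      with eval_det[OF eA, of n z] e'(2) show "gn (A n) \<in> W i" unfolding W_def by auto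
    next
      assume "gn (A n) \<in> W i"
      then obtain e y where e: "code e = i" "eval e [gn (A n)] y" unfolding W_def by blast
      have "eval (Comp e [eA]) [n] y" by (rule eval.Comp[OF _ _ e(2)]) (auto simp: eA)
      moreover have "code (Comp e [eA]) = h i" using e(1) by (simp add: h_def)
      ultimately show "n \<in> W (h i)" unfolding W_def by blast
    qed
    then show ?thesis by blast
  qed
  \<comment> \<open>Both indices are pulled back along \<open>A\<close>; the given function finds a
    number outside both preimages, and its image under \<open>A\<close> avoids both sets.\<close>
  define g where "g i j = gn (A (f (h i) (h j)))" for i j
  have "recursive_fun2 g"
    unfolding recursive_fun2_iff g_def h_def
    by (intro computable_comp[OF computable_gn_A] computable_comp2[OF f[unfolded recursive_fun2_iff]]
        computable_intros)
  moreover have "g i j \<notin> W i \<union> W j"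
    if "provable_set (J_ext B C) \<subseteq> W i" "refutable_set (J_ext B C) \<subseteq> W j" "W i \<inter> W j = {}" for i j
  proof -
    have "B \<subseteq> W (h i)" "C \<subseteq> W (h j)" "W (h i) \<inter> W (h j) = {}"
      unfolding W_h using that A_provable A_refutable by blast+
    from ei[OF this] show ?thesis unfolding W_h g_def by simp
  qed
  moreover have "disjoint_RE_pair (provable_set (J_ext B C)) (refutable_set (J_ext B C))"
    using assms disjoint_RE_pair_J_ext by (simp add: EI_def)
  ultimately show ?thesis unfolding EI_theory_def EI_def by blast
qed

theorem theorem3p12:
  fixes B C :: "nat set"
  assumes "disjoint_RE_pair B C"
  shows "\<not> interprets (J_ext B C) R \<and>
    (RI B C \<longrightarrow> RI_theory (J_ext B C)) \<and>
    (EI B C \<longrightarrow> EI_theory (J_ext B C))"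
  using assms J_ext_not_interprets RI_J_ext EI_J_ext unfolding disjoint_RE_pair_def by blast

end
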